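(* For every complex number $q$ with $0<|q|<1$, \begin{align*} \sum_{n=0}^\infty \frac{q^{n^2}(-q;q)^2_n}{(q;q)_{2n}}&=\frac{1}{(q;q)_\infty}\sum_{n=0}^{\infty}\sum_{m=0}^{n}(1-q^{6n+6})q^{2n^2+n-m(m+1)/2} =\frac{1}{(q;q)_\infty}f_{4,4,3}(-q^3,-q^2;q),\\ \sum_{n=0}^\infty \frac{q^{n^2}}{(q;q^2)_n}&=\frac{1}{(q;q)_\infty}\sum_{n=0}^\infty\sum_{m=0}^n(-1)^n(1-q^{6n+6})q^{2n^2+n-m(m+1)/2} =\frac{1}{(q;q)_\infty}f_{4,4,3}(q^3,q^2;q),\\ \sum_{n=0}^\infty \frac{(-1)^n(q;q^2)_nq^{n^2+n}}{(-q;q)_{2n}}&=\sum_{n=0}^{\infty} \sum_{|m|\leq n}(-1)^{m+n}(1-q^{4n+2})q^{3n^2+n-m^2}\\ &=g_{1,2,1}(-q^{3},-q^{3};q^4)-q^4g_{1,2,1}(-q^{9},-q^{9};q^4). \end{align*}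
   Context: Notation: $(x;q)_n:=\prod_{i=0}^{n-1}(1-q^ix)$, $(x;q)_\infty:=\prod_{i=0}^{\infty}(1-q^ix)$, and $(x;q)_n^2$ means $((x;q)_n)^2$. Type I and type II double-sums: $$f_{a,b,c}(x,y;q):=\Big(\sum_{r,s\ge 0}-\sum_{r,s<0}\Big)(-1)^{r+s}x^ry^sq^{a\binom r2+brs+c\binom s2},$$ $$g_{a,b,c}(x,y;q):=\Big(\sum_{r,s\ge 0}+\sum_{r,s<0}\Big)(-1)^{r+s}x^ry^sq^{a\binom r2+brs+c\binom s2},$$ where $r,s$ run over integers, the first sum is over pairs with both $r,s\ge0$ and the second over pairs with both $r,s<0$, and $\binom{r}{2}=r(r-1)/2$ for all integers $r$. *)

theory Defs
  imports "HOL-Analysis.Analysis"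
begin

definition qpoch :: "complex \<Rightarrow> complex \<Rightarrow> nat \<Rightarrow> complex" where
  "qpoch x q n = (\<Prod>i<n. 1 - q ^ i * x)"

definition qpoch_inf :: "complex \<Rightarrow> complex \<Rightarrow> complex" where
  "qpoch_inf x q = (\<Prod>i. 1 - q ^ i * x)"

(* r(r-1)/2 for all integers r, negative ones included; the division is exact. *)
definition binom2 :: "int \<Rightarrow> int" where
  "binom2 r = r * (r - 1) div 2"

definition dsum_term ::
  "int \<Rightarrow> int \<Rightarrow> int \<Rightarrow> complex \<Rightarrow> complex \<Rightarrow> complex \<Rightarrow> int \<Rightarrow> int \<Rightarrow> complex" where
  "dsum_term a b c x y q r s =
     (-1) powi (r + s) * x powi r * y powi s
       * q powi (a * binom2 r + b * r * s + c * binom2 s)"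

(* For a, c > 0, b \<ge> 0, 0 < |q| < 1 and nonzero x, y both sums below converge
   absolutely, so the unordered sums are the usual double sums. *)
definition dsum_f ::
  "int \<Rightarrow> int \<Rightarrow> int \<Rightarrow> complex \<Rightarrow> complex \<Rightarrow> complex \<Rightarrow> complex" where
  "dsum_f a b c x y q =
     (\<Sum>\<^sub>\<infinity>(r, s)\<in>{0..} \<times> {0..}. dsum_term a b c x y q r s)
     - (\<Sum>\<^sub>\<infinity>(r, s)\<in>{..<0} \<times> {..<0}. dsum_term a b c x y q r s)"

definition dsum_g ::
  "int \<Rightarrow> int \<Rightarrow> int \<Rightarrow> complex \<Rightarrow> complex \<Rightarrow> complex \<Rightarrow> complex" where
  "dsum_g a b c x y q =
     (\<Sum>\<^sub>\<infinity>(r, s)\<in>{0..} \<times> {0..}. dsum_term a b c x y q r s)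
     + (\<Sum>\<^sub>\<infinity>(r, s)\<in>{..<0} \<times> {..<0}. dsum_term a b c x y q r s)"

end

theory Submission
  imports Defs
begin

text \<open>
  Each left-hand side is a sum over \<open>n\<close> of \<open>\<delta>\<^sub>n * \<beta>\<^sub>n\<close>, where
  \<open>\<beta>\<^sub>n = (\<Sum>r\<le>n. \<alpha>\<^sub>r / ((q; q)\<^sub>n\<^sub>-\<^sub>r (q; q)\<^sub>n\<^sub>+\<^sub>r))\<close> is a Bailey pair relative to \<open>1\<close> (or its analogue relative to
  \<open>q\<^sup>2\<close>, in base \<open>q\<^sup>2\<close>, for the third identity), and \<open>\<alpha>\<^sub>r\<close> contains a partial sum of a theta function. The
  product formula for \<open>\<beta>\<^sub>n\<close> follows from a first-order recurrence in \<open>n\<close>, proved by telescoping in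
  \<open>r\<close>. Interchanging the summations, the inner sums over \<open>n\<close> are two limiting cases of the q-Gauss sum:
  \<open>\<delta>\<^sub>n = q ^ n\<^sup>2\<close> gives \<open>q ^ r\<^sup>2 / (q; q)\<^sub>\<infinity>\<close>, and \<open>\<delta>\<^sub>n = (-1) ^ n * q ^ (n\<^sup>2 + n) * (q\<^sup>2; q\<^sup>2)\<^sub>n\<close> gives
  \<open>(-1) ^ r * q ^ (r\<^sup>2 + r)\<close>. Finally the substitution \<open>n = r + s\<close> turns the sums over \<open>m \<le> n\<close> into sums over
  quadrants; the second quadrant comes from the term \<open>q ^ (6 * n + 6)\<close>, and for the third identity
  \<open>m = r - s\<close> with the parity of \<open>m + n\<close> separating the two double sums.
\<close>

section \<open>A limiting case of the q-Gauss summation\<close>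

lemma qpoch_0 [simp]: "qpoch x q 0 = 1"
  by (simp add: qpoch_def)

lemma qpoch_Suc: "qpoch x q (Suc n) = qpoch x q n * (1 - q ^ n * x)"
  by (simp add: qpoch_def)

lemma qpoch_add: "qpoch x q (m + n) = qpoch x q m * qpoch (x * q ^ m) q n"
  by (induction n) (simp_all add: qpoch_Suc power_add mult_ac)

lemma qpoch_Suc_left: "qpoch x q (Suc n) = (1 - x) * qpoch (x * q) q n"
  using qpoch_add[of x q 1 n] by (simp add: qpoch_Suc)

lemma norm_pow_mult_less_1:
  fixes q x :: complex
  assumes "norm q < 1" "norm x < 1"
  shows "norm (q ^ i * x) < 1"
proof -
  have "norm q ^ i * norm x \<le> 1 * norm x"
    using assms by (intro mult_right_mono power_le_one) auto
  then show ?thesis using assms by (simp add: norm_mult norm_power)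
qed

lemma one_minus_pow_mult_nonzero:
  fixes q x :: complex
  assumes "norm q < 1" "norm x < 1"
  shows "1 - q ^ i * x \<noteq> 0"
  using norm_pow_mult_less_1[OF assms, of i] by auto

lemma qpoch_nonzero:
  assumes "norm q < 1" "norm x < 1"
  shows "qpoch x q n \<noteq> 0"
  using one_minus_pow_mult_nonzero[OF assms] by (simp add: qpoch_def)

lemma convergent_prod_qpoch:
  fixes q x :: complex
  assumes "norm q < 1"
  shows "convergent_prod (\<lambda>i. 1 - q ^ i * x)"
proof -
  have "summable (\<lambda>i. norm q ^ i * norm x)"
    using assms by (intro summable_mult2 summable_geometric) simp
  then show ?thesis
    by (intro abs_convergent_prod_imp_convergent_prod)
       (simp add: abs_convergent_prod_conv_summable norm_mult norm_power )
qed

lemma qpoch_tendsto: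
  assumes "norm q < 1"
  shows "qpoch x q \<longlonglongrightarrow> qpoch_inf x q"
proof -
  have "(\<lambda>n. qpoch x q (Suc n)) \<longlonglongrightarrow> qpoch_inf x q"
    using convergent_prod_LIMSEQ[OF convergent_prod_qpoch[OF assms, of x]]
    by (simp add: qpoch_def qpoch_inf_def lessThan_Suc_atMost)
  then show ?thesis by (simp only: filterlim_sequentially_Suc)
qed

lemma qpoch_inf_nonzero:
  assumes "norm q < 1" "norm x < 1"
  shows "qpoch_inf x q \<noteq> 0"
  unfolding qpoch_inf_def
  using convergent_prod_qpoch[OF assms(1)] one_minus_pow_mult_nonzero[OF assms]
  by (rule prodinf_nonzero)

lemma qpoch_bounded:
  assumes "norm q < 1"
  obtains K where "K > 0" "\<And>n. norm (qpoch x q n) \<le> K"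
  using convergent_imp_Bseq[OF convergentI[OF qpoch_tendsto[OF assms, of x]]]
  by (auto elim: BseqE)

text \<open>The products converge to a nonzero limit, so their inverses converge as well.\<close>

lemma inverse_qpoch_bounded:
  assumes "norm q < 1" "norm x < 1"
  obtains K where "K > 0" "\<And>n. norm (inverse (qpoch x q n)) \<le> K"
  using convergent_imp_Bseq[OF convergentI[OF tendsto_inverse[OF qpoch_tendsto[OF assms(1)]
          qpoch_inf_nonzero[OF assms]]]]
  by (auto elim: BseqE)

section \<open>The limiting q-Gauss series\<close>

text \<open>
  With \<open>b = 1 / a\<close> this is the q-Gauss summand in which one upper parameter has tended to infinity
  and \<open>a\<close> is left: \<open>\<Prod>i<j. q ^ i - b\<close> is \<open>(a; q)\<^sub>j\<close> up to the factor \<open>(- b) ^ j\<close>. In this form \<open>b = 0\<close>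
  is allowed, which gives the case where both upper parameters have tended to infinity.
\<close>

definition gauss_coeff :: "complex \<Rightarrow> complex \<Rightarrow> nat \<Rightarrow> complex" where
  "gauss_coeff b q j = (\<Prod>i<j. q ^ i * (q ^ i - b))"

definition gauss_term :: "complex \<Rightarrow> complex \<Rightarrow> complex \<Rightarrow> nat \<Rightarrow> complex" where
  "gauss_term b q c j = gauss_coeff b q j * c ^ j / (qpoch q q j * qpoch c q j)"

text \<open>The ratio of consecutive terms, \<open>q ^ j * (q ^ j - b) * c\<close>, tends to
  0.\<close>

lemma summable_gauss_majorant:
  fixes q :: complex
  assumes "norm q < 1"
  shows "summable (\<lambda>j. norm (gauss_coeff b q j * c ^ j))"
proof -
  have "(\<lambda>j. norm (q ^ j * (q ^ j - b) * c)) \<longlonglongrightarrow> norm ((0::complex) * (0 - b) * c)"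
    by (intro tendsto_intros LIMSEQ_power_zero assms)
  then have "(\<lambda>j. norm (q ^ j * (q ^ j - b) * c)) \<longlonglongrightarrow> 0"
    by simp
  then have "eventually (\<lambda>j. norm (q ^ j * (q ^ j - b) * c) < 1 / 2) sequentially"
    by (rule order_tendstoD) simp
  then obtain N where N: "norm (q ^ j * (q ^ j - b) * c) < 1 / 2" if "j \<ge> N" for j
    by (auto simp: eventually_sequentially)
  show ?thesis
  proof (rule summable_ratio_test[of "1/2" N])
    fix n assume "N \<le> n"
    have "norm (gauss_coeff b q (Suc n) * c ^ Suc n)
        = norm (q ^ n * (q ^ n - b) * c) * norm (gauss_coeff b q n * c ^ n)"
      by (simp add: gauss_coeff_def norm_mult mult_ac)
    also have "\<dots> \<le> 1 / 2 * norm (gauss_coeff b q n * c ^ n)"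
      using N[OF \<open>N \<le> n\<close>] by (intro mult_right_mono) auto
    finally show "norm (norm (gauss_coeff b q (Suc n) * c ^ Suc n))
        \<le> 1 / 2 * norm (norm (gauss_coeff b q n * c ^ n))" by simp
  qed simp
qed

text \<open>The bound is uniform in \<open>N\<close>, as dominated convergence along
  \<open>c * q ^ N\<close> requires. The shifted denominator is controlled by 1/(c q^N; q)_j = (c;
  q)_N / (c; q)_(N+j), both parts of which are bounded.\<close>

lemma gauss_term_bound:
  fixes q c :: complex
  assumes "norm q < 1" "norm c < 1"
  obtains K where "K > 0"
    "\<And>N j. norm (gauss_term b q (c * q ^ N) j) \<le> K * norm (gauss_coeff b q j * c ^ j)"
proof -
  obtain K1 where K1: "K1 > 0" "\<And>n. norm (inverse (qpoch q q n)) \<le> K1"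
    using inverse_qpoch_bounded[OF assms(1) assms(1)] by blast
  obtain K2 where K2: "K2 > 0" "\<And>n. norm (inverse (qpoch c q n)) \<le> K2"
    using inverse_qpoch_bounded[OF assms] by blast
  obtain K3 where K3: "K3 > 0" "\<And>n. norm (qpoch c q n) \<le> K3"
    using qpoch_bounded[OF assms(1)] by blast
  have "norm (gauss_term b q (c * q ^ N) j) \<le> K1 * (K3 * K2) * norm (gauss_coeff b q j * c ^ j)"
    for N j
  proof -
    have "inverse (qpoch (c * q ^ N) q j) = qpoch c q N * inverse (qpoch c q (N + j))"
      using qpoch_nonzero[OF assms, of N] by (simp add: qpoch_add)
    then have "norm (inverse (qpoch (c * q ^ N) q j)) \<le> K3 * K2"
      unfolding norm_mult by (simp add: norm_mult mult_mono K2 K3 less_imp_le del: norm_inverse)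
    moreover have "norm (q ^ N) ^ j \<le> 1"
      using assms by (intro power_le_one) (auto simp: norm_power power_le_one)
    ultimately have "norm (gauss_coeff b q j * c ^ j) * norm (q ^ N) ^ j
        * (norm (inverse (qpoch q q j)) * norm (inverse (qpoch (c * q ^ N) q j)))
        \<le> norm (gauss_coeff b q j * c ^ j) * 1 * (K1 * (K3 * K2))"
      using K1 K2 K3 by (intro mult_mono) (auto intro!: mult_nonneg_nonneg less_imp_le)
    then show ?thesis
      by (simp add: gauss_term_def norm_mult norm_divide norm_power power_mult_distrib
          norm_inverse field_simps)
  qed
  then show ?thesis using that[of "K1 * (K3 * K2)"] K1 K2 K3 by auto
qed

lemma summable_norm_gauss_term:
  fixes q c :: complex
  assumes "norm q < 1" "norm c < 1"
  shows "summable (\<lambda>j. norm (gauss_term b q c j))"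
proof -
  obtain K where "K > 0"
    "\<And>N j. norm (gauss_term b q (c * q ^ N) j) \<le> K * norm (gauss_coeff b q j * c ^ j)"
    using gauss_term_bound[OF assms] by metis
  from this(2)[of 0] show ?thesis
    by (intro summable_comparison_test'[OF summable_mult[OF
          summable_gauss_majorant[OF assms(1)], of K]]) simp
qed

text \<open>Tannery's theorem: for \<open>j > 0\<close> the factor \<open>(c * q ^ N) ^ j\<close>
  kills the term as \<open>N\<close> grows, and the term \<open>j = 0\<close> is always 1.\<close>

lemma suminf_gauss_term_tendsto_1:
  fixes q c :: complex
  assumes "norm q < 1" "norm c < 1"
  shows "(\<lambda>N. \<Sum>j. gauss_term b q (c * q ^ N) j) \<longlonglongrightarrow> 1"
proof -
  obtain K where K: "K > 0"
    "\<And>N j. norm (gauss_term b q (c * q ^ N) j) \<le> K * norm (gauss_coeff b q j * c ^ j)"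
    using gauss_term_bound[OF assms] by metis
  have lim: "(\<lambda>N. gauss_term b q (c * q ^ N) j) \<longlonglongrightarrow> (if j = 0 then 1 else 0)" for j
  proof (cases j)
    case 0
    then show ?thesis by (simp add: gauss_term_def gauss_coeff_def)
  next
    case (Suc i)
    have "(\<lambda>N. c * q ^ N) \<longlonglongrightarrow> c * 0"
      by (intro tendsto_intros LIMSEQ_power_zero assms)
    moreover have "qpoch 0 q j = 1"
      by (simp add: qpoch_def)
    ultimately have "(\<lambda>N. gauss_term b q (c * q ^ N) j)
        \<longlonglongrightarrow> gauss_coeff b q j * 0 ^ j / (qpoch q q j * qpoch 0 q j)"
      unfolding gauss_term_def qpoch_def[of "_ * _"] qpoch_def[of 0]
      by (intro tendsto_intros) (auto simp: qpoch_nonzero assms)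
    then show ?thesis using Suc by simp
  qed
  have "(\<lambda>N. \<Sum>j. gauss_term b q (c * q ^ N) j) \<longlonglongrightarrow> (\<Sum>j. if j = 0 then 1 else 0)"
    using tannerys_theorem[OF lim _ summable_mult[OF summable_gauss_majorant[OF assms(1), of b c],
          of K]] K(2) by (simp add: always_eventually)
  moreover have "(\<Sum>j. if j = 0 then 1 else 0) = (1::complex)"
    using suminf_finite[of "{0::nat}" "\<lambda>j. if j = 0 then 1 else (0::complex)"] by simp
  ultimately show ?thesis by simp
qed

text \<open>
  The sum \<open>\<phi> c\<close> ought to satisfy \<open>(1 - c) * \<phi> c = (1 - b * c) * \<phi> (c * q)\<close>. This does not telescope termwise,
  but the defect reproduces itself at \<open>c * q\<close> with a factor tending to \<open>0\<close>, hence vanishes.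
\<close>

definition gauss_defect :: "complex \<Rightarrow> complex \<Rightarrow> complex \<Rightarrow> complex" where
  "gauss_defect b q c =
     (1 - c) * (\<Sum>j. gauss_term b q c j) - (1 - b * c) * (\<Sum>j. gauss_term b q (c * q) j)"

lemma gauss_defect_step:
  fixes q c :: complex
  assumes q: "norm q < 1" and c: "norm c < 1"
  shows "gauss_defect b q c = - c / (1 - c * q) * gauss_defect b q (c * q)"
proof -
  \<comment> \<open>\<open>h x\<close> is the summand of the defect at \<open>x\<close> over the
    common denominator (q; q)_j (xq; q)_j; the last factor is (1 - q^j x) - q^j (1 - b x), regrouped
    so that \<open>1 - q ^ j\<close> can cancel against (q; q)_j.\<close>
  define h where "h x j = gauss_coeff b q j * x ^ j / (qpoch q q j * qpoch (x * q) q j)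
      * ((1 - q ^ j) - x * q ^ j * (1 - b))" for x j
  have defect_sums: "h x sums gauss_defect b q x" if x: "norm x < 1" for x
  proof -
    have xq: "norm (x * q) < 1"
      using norm_pow_mult_less_1[OF q x, of 1] by (simp add: mult_ac)
    have "h x j = (1 - x) * gauss_term b q x j - (1 - b * x) * gauss_term b q (x * q) j" for j
    proof -
      have "(1 - x) / qpoch x q j = (1 - q ^ j * x) / qpoch (x * q) q j"
        using qpoch_Suc[of x q j] qpoch_Suc_left[of x q j] qpoch_nonzero[OF q x, of j]
          qpoch_nonzero[OF q xq, of j] by (simp add: field_simps)
      then have "(1 - x) * gauss_term b q x j
          = gauss_coeff b q j * x ^ j / (qpoch q q j * qpoch (x * q) q j) * (1 - q ^ j * x)"
        unfolding gauss_term_def by (metis (no_types, lifting) mult.commute times_divide_times_eq times_divide_eq_left)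
      moreover have "(1 - b * x) * gauss_term b q (x * q) j
          = gauss_coeff b q j * x ^ j / (qpoch q q j * qpoch (x * q) q j) * (q ^ j * (1 - b * x))"
        unfolding gauss_term_def by (simp add: power_mult_distrib)
      ultimately show ?thesis
        unfolding h_def by (simp only: right_diff_distrib [symmetric]) (simp add: algebra_simps)
    qed
    then have "h x = (\<lambda>j. (1 - x) * gauss_term b q x j - (1 - b * x) * gauss_term b q (x * q) j)"
      by (rule ext)
    then show ?thesis
      unfolding gauss_defect_def
      by (simp only:) (intro sums_diff sums_mult summable_sums[OF summable_norm_cancel[OF
          summable_norm_gauss_term]] q x xq)
  qed
  have cq: "norm (c * q) < 1"
    using norm_pow_mult_less_1[OF q c, of 1] by (simp add: mult_ac)
  define p where "p j = gauss_coeff b q j * c ^ j / (qpoch q q j * qpoch (c * q) q j)" for j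
  have p_sum: "summable (\<lambda>j. p j * q ^ j)"
  proof -
    have "summable (gauss_term b q (c * q))"
      by (rule summable_norm_cancel[OF summable_norm_gauss_term[OF q cq]])
    then show ?thesis by (simp add: gauss_term_def [abs_def] p_def power_mult_distrib mult_ac)
  qed
  \<comment> \<open>The part of the defect with factor \<open>1 - q ^ j\<close> is shifted by one before it is
    recombined with the rest.\<close>
  have shift: "p (Suc j) * (1 - q ^ Suc j) = c * (p j * q ^ j * (q ^ j - b)) / (1 - c * q * q ^ j)" for j
  proof -
    have "1 - q ^ Suc j \<noteq> 0" using one_minus_pow_mult_nonzero[OF q q, of j] by (simp add: mult_ac)
    then show ?thesis
      by (simp add: p_def gauss_coeff_def qpoch_Suc mult_ac)
  qed
  have first: "(\<lambda>j. p j * (1 - q ^ j)) sums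
       (gauss_defect b q c + c * (1 - b) * (\<Sum>j. p j * q ^ j))"
  proof -
    have "(\<lambda>j. h c j + c * (1 - b) * (p j * q ^ j)) sums
       (gauss_defect b q c + c * (1 - b) * (\<Sum>j. p j * q ^ j))"
      by (intro sums_add defect_sums c sums_mult summable_sums p_sum)
    moreover have "h c j + c * (1 - b) * (p j * q ^ j) = p j * (1 - q ^ j)" for j
      unfolding h_def p_def[symmetric] by (simp add: algebra_simps)
    ultimately show ?thesis by simp
  qed
  \<comment> \<open>The term \<open>j = 0\<close> contains \<open>1 - q ^ 0 = 0\<close>, so dropping
    it leaves the sum unchanged.\<close>
  have "(\<lambda>j. p (Suc j) * (1 - q ^ Suc j)) sums
       (gauss_defect b q c + c * (1 - b) * (\<Sum>j. p j * q ^ j))"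
    using sums_Suc_imp[of "\<lambda>j. p j * (1 - q ^ j)"] first
    by (subst sums_Suc_iff) simp
  then have "(\<lambda>j. p (Suc j) * (1 - q ^ Suc j) - c * (1 - b) * (p j * q ^ j)) sums
       (gauss_defect b q c + c * (1 - b) * (\<Sum>j. p j * q ^ j) - c * (1 - b) * (\<Sum>j. p j * q ^ j))"
    by (intro sums_diff sums_mult summable_sums p_sum)
  moreover have "p (Suc j) * (1 - q ^ Suc j) - c * (1 - b) * (p j * q ^ j)
      = - c / (1 - c * q) * h (c * q) j" for j
  proof -
    have nz: "1 - c * q * q ^ j \<noteq> 0"
      using one_minus_pow_mult_nonzero[OF q cq, of j] by (simp add: mult_ac)
    have "(1 - c * q) * qpoch (c * q * q) q j = qpoch (c * q) q j * (1 - c * q * q ^ j)"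
      using qpoch_Suc[of "c * q" q j] qpoch_Suc_left[of "c * q" q j] by (simp add: mult_ac)
    then have "h (c * q) j / (1 - c * q) = gauss_coeff b q j * (c * q) ^ j
        / (qpoch q q j * (qpoch (c * q) q j * (1 - c * q * q ^ j)))
        * ((1 - q ^ j) - c * q * q ^ j * (1 - b))"
      unfolding h_def by (metis (no_types, lifting) divide_divide_eq_left mult.assoc mult.commute times_divide_eq_left)
    also have "\<dots> = p j * q ^ j * ((1 - q ^ j) - c * q * q ^ j * (1 - b)) / (1 - c * q * q ^ j)"
      by (simp add: p_def power_mult_distrib mult_ac)
    finally have *: "h (c * q) j / (1 - c * q) = \<dots>" .
    have "p (Suc j) * (1 - q ^ Suc j) - c * (1 - b) * (p j * q ^ j)
      = - c * (p j * q ^ j * ((1 - q ^ j) - c * q * q ^ j * (1 - b)) / (1 - c * q * q ^ j))"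
      unfolding shift using nz by (simp add: divide_simps) (simp add: algebra_simps)
    then show ?thesis unfolding *[symmetric] by simp
  qed
  ultimately have "(\<lambda>j. - c / (1 - c * q) * h (c * q) j) sums gauss_defect b q c"
    by simp
  moreover have "(\<lambda>j. - c / (1 - c * q) * h (c * q) j) sums
      (- c / (1 - c * q) * gauss_defect b q (c * q))"
    by (intro sums_mult defect_sums cq)
  ultimately show ?thesis by (rule sums_unique2)
qed

text \<open>Along \<open>c * q ^ N\<close> the defect tends to 0, since both series tend to 1. But
  once the factor \<open>k N\<close> has norm below 1, the norm of the defect can only grow with
  \<open>N\<close>, so it must already be 0 there.\<close>

lemma gauss_defect_eq_0:
  fixes q c :: complex
  assumes q: "norm q < 1" and c: "norm c < 1"
  shows "gauss_defect b q c = 0"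
proof -
  define d where "d N = gauss_defect b q (c * q ^ N)" for N
  define k where "k N = - (c * q ^ N) / (1 - c * q ^ N * q)" for N
  have cN: "norm (c * q ^ N) < 1" for N
    using norm_pow_mult_less_1[OF q c, of N] by (simp add: mult_ac)
  have step: "d N = k N * d (Suc N)" for N
    unfolding d_def k_def using gauss_defect_step[OF q cN[of N], of b] by (simp add: mult_ac)
  have cq0: "(\<lambda>N. c * q ^ N) \<longlonglongrightarrow> c * 0"
    by (intro tendsto_intros LIMSEQ_power_zero q)
  have "k \<longlonglongrightarrow> - (c * 0) / (1 - c * 0 * q)"
    unfolding k_def by (intro tendsto_intros cq0) auto
  then have "(\<lambda>N. norm (k N)) \<longlonglongrightarrow> 0"
    by (simp add: tendsto_norm_zero)
  then have "eventually (\<lambda>N. norm (k N) < 1) sequentially"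
    by (rule order_tendstoD) simp
  then obtain N0 where N0: "norm (k N) < 1" if "N \<ge> N0" for N
    by (auto simp: eventually_sequentially)
  have "d \<longlonglongrightarrow> (1 - c * 0) * 1 - (1 - b * (c * 0)) * 1"
    unfolding d_def gauss_defect_def
    using LIMSEQ_Suc[OF suminf_gauss_term_tendsto_1[OF q c, of b]]
    by (intro tendsto_intros cq0 suminf_gauss_term_tendsto_1[OF q c]) (simp add: mult_ac)
  then have d0: "(\<lambda>N. norm (d N)) \<longlonglongrightarrow> 0"
    by (simp add: tendsto_norm_zero)
  have "norm (d N) \<le> norm (d (Suc N))" if "N \<ge> N0" for N
    using N0[OF that] by (subst step) (simp add: norm_mult mult_left_le_one_le less_imp_le)
  then have "incseq (\<lambda>N. norm (d (N + N0)))"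
    by (intro incseq_SucI) simp
  then have "norm (d (0 + N0)) \<le> 0"
    using LIMSEQ_ignore_initial_segment[OF d0, of N0] by (rule incseq_le)
  then have "d N0 = 0" by simp
  \<comment> \<open>\<open>step\<close> carries the zero at \<open>N0\<close> back to the index
    0.\<close>
  moreover have "d M = 0 \<Longrightarrow> d 0 = 0" for M
  proof (induction M)
    case (Suc M)
    then show ?case using step[of M] by simp
  qed simp
  ultimately have "d 0 = 0" by blast
  then show ?thesis by (simp add: d_def)
qed

text \<open>The functional equation (1 - c) phi(c) = (1 - b c) phi(c q) is iterated \<open>N\<close>
  times; then \<open>N\<close> tends to infinity, where phi(c q^N) tends to 1.\<close>

lemma gauss_sum:
  fixes q c :: complex
  assumes q: "norm q < 1" and c: "norm c < 1"
  shows "gauss_term b q c sums (qpoch_inf (b * c) q / qpoch_inf c q)"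
proof -
  define \<phi> where "\<phi> N = (\<Sum>j. gauss_term b q (c * q ^ N) j)" for N
  have cN: "norm (c * q ^ N) < 1" for N
    using norm_pow_mult_less_1[OF q c, of N] by (simp add: mult_ac)
  have step: "(1 - c * q ^ N) * \<phi> N = (1 - b * (c * q ^ N)) * \<phi> (Suc N)" for N
    using gauss_defect_eq_0[OF q cN, of b N] by (simp add: gauss_defect_def \<phi>_def mult_ac)
  have "qpoch c q N * \<phi> 0 = qpoch (b * c) q N * \<phi> N" for N
  proof (induction N)
    case (Suc N)
    have "qpoch c q (Suc N) * \<phi> 0 = (1 - c * q ^ N) * (qpoch c q N * \<phi> 0)"
      by (simp add: qpoch_Suc mult_ac)
    also have "\<dots> = qpoch (b * c) q N * ((1 - c * q ^ N) * \<phi> N)"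
      by (simp only: Suc.IH) (simp add: mult_ac)
    also have "\<dots> = qpoch (b * c) q (Suc N) * \<phi> (Suc N)"
      by (simp only: step) (simp add: qpoch_Suc mult_ac)
    finally show ?case .
  qed simp
  moreover have "(\<lambda>N. qpoch c q N * \<phi> 0) \<longlonglongrightarrow> qpoch_inf c q * \<phi> 0"
    by (intro tendsto_intros qpoch_tendsto q)
  moreover have "(\<lambda>N. qpoch (b * c) q N * \<phi> N) \<longlonglongrightarrow> qpoch_inf (b * c) q * 1"
    unfolding \<phi>_def by (intro tendsto_intros qpoch_tendsto suminf_gauss_term_tendsto_1 q c)
  ultimately have "qpoch_inf c q * \<phi> 0 = qpoch_inf (b * c) q"
    using LIMSEQ_unique by fastforce
  then have "\<phi> 0 = qpoch_inf (b * c) q / qpoch_inf c q"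
    using qpoch_inf_nonzero[OF q c] by (simp add: field_simps)
  moreover have "gauss_term b q c sums \<phi> 0"
    unfolding \<phi>_def
    using summable_sums[OF summable_norm_cancel[OF summable_norm_gauss_term[OF q c]]] by simp
  ultimately show ?thesis by simp
qed

section \<open>Bailey pairs from telescoping certificates\<close>

text \<open>
  Reading \<open>1 / (q; q)\<^sub>k\<close> as \<open>0\<close> for \<open>k < 0\<close> makes the recurrence below hold for all integers \<open>k\<close>, so that
  no boundary cases arise.
\<close>

definition ipoch :: "complex \<Rightarrow> int \<Rightarrow> complex" where
  "ipoch q k = (if k < 0 then 0 else inverse (qpoch q q (nat k)))"

text \<open>At \<open>k = 0\<close> the factor \<open>1 - q powi 0\<close> vanishes, matching the
  value 0 at \<open>-1\<close>; this makes the convention consistent.\<close>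

lemma ipoch_pred:
  assumes "norm q < 1"
  shows "ipoch q (k - 1) = (1 - q powi k) * ipoch q k"
proof (cases "k > 0")
  case True
  define m where "m = nat (k - 1)"
  have k: "k = int (Suc m)" using True by (simp add: m_def)
  have "1 - q ^ m * q \<noteq> 0"
    using one_minus_pow_mult_nonzero[OF assms assms] .
  moreover have "ipoch q (k - 1) = inverse (qpoch q q m)" "ipoch q k = inverse (qpoch q q (Suc m))"
    by (simp_all add: ipoch_def k nat_add_distrib)
  moreover have "q powi k = q ^ m * q"
    unfolding k power_int_of_nat by (simp add: mult.commute)
  ultimately show ?thesis
    by (simp add: qpoch_Suc)
next
  case False
  then show ?thesis by (cases "k = 0") (auto simp: ipoch_def)
qed

text \<open>The kernel of a Bailey pair in base q: relative to 1 for \<open>e = 0\<close>, relative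
  to q for \<open>e = 1\<close>. In the latter case (q^2; q)_(n+r) = (q; q)_(n+r+1) / (1 - q), and
  the constant 1 - q is absorbed into the alpha sequence.\<close>

definition bweight :: "complex \<Rightarrow> int \<Rightarrow> int \<Rightarrow> int \<Rightarrow> complex" where
  "bweight q e n r = ipoch q (n - r) * ipoch q (n + r + e)"

lemma bweight_eq_0: "r > n \<Longrightarrow> bweight q e n r = 0"
  by (simp add: bweight_def ipoch_def)

text \<open>The reflection exchanges the two factors. It removes the index \<open>-1\<close> that
  appears at the lower end of the telescoping sums.\<close>

lemma bweight_reflect: "bweight q e n (- e - r) = bweight q e n r"
  by (simp add: bweight_def algebra_simps)

text \<open>With a = q^(n-r) and b = q^(n+r+e), every weight is a multiple of the same product
  \<open>P * R\<close>, which leaves the identity (1 - ab)(1 - ab/q) = b(1 - a)(1 - a/q) + (1 +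
  ab/q)(1 - a)(1 - b) + a(1 - b)(1 - b/q).\<close>

lemma bweight_rec:
  assumes "q \<noteq> 0" "norm q < 1"
  shows "(1 - q powi (2 * n + e)) * (1 - q powi (2 * n + e - 1)) * bweight q e n r
       = q powi (n + r + e) * bweight q e (n - 1) (r + 1)
         + (1 + q powi (2 * n + e - 1)) * bweight q e (n - 1) r
         + q powi (n - r) * bweight q e (n - 1) (r - 1)"
proof -
  define a b P R where "a = q powi (n - r)" and "b = q powi (n + r + e)"
    and "P = ipoch q (n - r)" and "R = ipoch q (n + r + e)"
  have ab: "q powi (2 * n + e) = a * b"
    using assms by (simp add: a_def b_def flip: power_int_add)
  have abq: "q powi (2 * n + e - 1) = a * b / q"
    using assms ab by (simp add: power_int_diff)
  have aq: "q powi (n - r - 1) = a / q" and bq: "q powi (n + r + e - 1) = b / q"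
    using assms by (simp_all add: a_def b_def power_int_diff)
  have p1: "ipoch q (n - r - 1) = (1 - a) * P" and p2: "ipoch q (n + r + e - 1) = (1 - b) * R"
    unfolding a_def b_def P_def R_def by (rule ipoch_pred[OF assms(2)])+
  have p3: "ipoch q (n - r - 1 - 1) = (1 - a / q) * ((1 - a) * P)"
    and p4: "ipoch q (n + r + e - 1 - 1) = (1 - b / q) * ((1 - b) * R)"
    by (simp_all only: ipoch_pred[OF assms(2), of "_ - 1"] p1 p2 aq bq)
  have w: "bweight q e (n - 1) (r + 1) = ipoch q (n - r - 1 - 1) * ipoch q (n + r + e)"
    "bweight q e (n - 1) r = ipoch q (n - r - 1) * ipoch q (n + r + e - 1)"
    "bweight q e (n - 1) (r - 1) = ipoch q (n - r) * ipoch q (n + r + e - 1 - 1)"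
    by (simp_all add: bweight_def algebra_simps)
  show ?thesis
    unfolding w p1 p2 p3 p4 ab abq a_def[symmetric] b_def[symmetric]
    unfolding bweight_def P_def[symmetric] R_def[symmetric]
    using assms(1) by (simp add: field_simps)
qed

text \<open>Both sides equal \<open>ipoch q (n - r - 1) * ipoch q (n + r + e)\<close>.\<close>

lemma bweight_shift:
  assumes "norm q < 1"
  shows "(1 - q powi (n - r)) * bweight q e n r = (1 - q powi (n + r + e + 1)) * bweight q e n (r + 1)"
proof -
  have "ipoch q (n - (r + 1)) = (1 - q powi (n - r)) * ipoch q (n - r)"
    using ipoch_pred[OF assms, of "n - r"] by (simp add: algebra_simps)
  moreover have "ipoch q (n + r + e) = (1 - q powi (n + r + e + 1)) * ipoch q (n + r + e + 1)"
    using ipoch_pred[OF assms, of "n + r + e + 1"] by (simp add: algebra_simps)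
  moreover have "n + (r + 1) + e = n + r + e + 1"
    by simp
  ultimately show ?thesis by (simp only: bweight_def mult_ac)
qed

section \<open>The Bailey pair for the first two identities\<close>

definition tri_inv :: "complex \<Rightarrow> nat \<Rightarrow> complex" where
  "tri_inv q m = inverse (q ^ (m * (m + 1) div 2))"

definition tri_sum :: "complex \<Rightarrow> nat \<Rightarrow> complex" where
  "tri_sum q n = (\<Sum>m\<le>n. tri_inv q m)"

lemma tri_inv_Suc: "tri_inv q (Suc m) = tri_inv q m / q ^ Suc m"
proof -
  have "Suc m * (Suc m + 1) div 2 = m * (m + 1) div 2 + Suc m"
    using div_mult_self1[of 2 "m * (m + 1)" "Suc m"] by (simp add: algebra_simps)
  then show ?thesis
    unfolding tri_inv_def by (simp add: power_add field_simps)
qed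

text \<open>
  Below, \<open>y = q ^ r\<close>, \<open>G = q ^ r\<^sup>2\<close>, and \<open>S\<close>, \<open>t\<close> stand for \<open>tri_sum q r\<close>, \<open>tri_inv q r\<close>; then
  \<open>S - t - y * t\<close> is \<open>tri_sum q (r - 2)\<close>, so the first function is
  \<open>q ^ (r\<^sup>2 + r) * S\<^sub>r - q ^ (r\<^sup>2 - r) * S\<^sub>r\<^sub>-\<^sub>2\<close>. The second one is the certificate: comparing coefficients of
  \<open>q ^ n\<close> in the desired recurrence leads to the two relations that follow, and the ansatz
  \<open>G * y * (A * S + B * t)\<close> solves both.
\<close>

definition bailey1_alpha :: "complex \<Rightarrow> complex \<Rightarrow> complex \<Rightarrow> complex \<Rightarrow> complex" where
  "bailey1_alpha G y S t = G * (y * S - (S - t - y * t) / y)"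

definition bailey1_cert :: "complex \<Rightarrow> complex \<Rightarrow> complex \<Rightarrow> complex \<Rightarrow> complex \<Rightarrow> complex \<Rightarrow> complex" where
  "bailey1_cert \<epsilon> q G y S t = G * y * (S * (1 + \<epsilon> - q * y - \<epsilon> / y) + t * (\<epsilon> / y - 1))"

text \<open>\<open>gm\<close> is the certificate at \<open>r - 1\<close>, its arguments expressed
  through the data at \<open>r\<close>. This is the relation for the coefficient of
  \<open>q ^ n\<close> to the first power.\<close>

lemma bailey1_cert_linear:
  fixes q y G S t \<epsilon> :: complex
  assumes "q \<noteq> 0" "y \<noteq> 0" "\<epsilon> = 1 \<or> \<epsilon> = -1"
  defines "gm \<equiv> bailey1_cert \<epsilon> q (G * q / y\<^sup>2) (y / q) (S - t) (y * t)"
  shows "(\<epsilon> - q) * bailey1_alpha G y S t = bailey1_cert \<epsilon> q G y S t / y - \<epsilon> * y * gm"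
  using assms(1,2,3) unfolding gm_def bailey1_alpha_def bailey1_cert_def
  by (elim disjE) (simp_all add: field_simps power2_eq_square)

text \<open>The relation for the coefficient free of \<open>q ^ n\<close>. The first and second
  alphas are those at \<open>r - 1\<close> and \<open>r + 1\<close>, again in terms of the data at
  \<open>r\<close>.\<close>

lemma bailey1_cert_const:
  fixes q y G S t \<epsilon> :: complex
  assumes "q \<noteq> 0" "y \<noteq> 0" "\<epsilon> = 1 \<or> \<epsilon> = -1"
  defines "gm \<equiv> bailey1_cert \<epsilon> q (G * q / y\<^sup>2) (y / q) (S - t) (y * t)"
  shows "y / q * bailey1_alpha (G * q / y\<^sup>2) (y / q) (S - t) (y * t)
       + bailey1_alpha (G * q * y\<^sup>2) (q * y) (S + t / (q * y)) (t / (q * y)) / (q * y)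
       - (1 + \<epsilon>) * bailey1_alpha G y S t = - (bailey1_cert \<epsilon> q G y S t - \<epsilon> * gm)"
  using assms(1,2,3) unfolding gm_def bailey1_alpha_def bailey1_cert_def
  by (elim disjE) (simp_all add: field_simps power2_eq_square)

text \<open>Intended reading: \<open>E\<close> is \<open>\<epsilon> ^ r\<close>, \<open>X\<close>
  and \<open>X'\<close> are \<open>q ^ (n + 1)\<close> and \<open>q ^ n\<close>, and
  \<open>B\<close>, \<open>Bp\<close>, \<open>Bm\<close> are the weights at \<open>r\<close>,
  \<open>r + 1\<close>, \<open>r - 1\<close>. The weights next to \<open>al\<close> match directly;
  \<open>rel\<close> turns the certificate part with \<open>Bp\<close> into one with
  \<open>B\<close>, after which \<open>1\<close> and \<open>2\<close> match its
  coefficients.\<close>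

lemma bailey1_telescope:
  fixes al alp alm ga gm B Bp Bm X X' y q \<epsilon> E :: complex
  assumes "q \<noteq> 0" "y \<noteq> 0" "\<epsilon> = 1 \<or> \<epsilon> = -1" and X: "X = q * X'"
  assumes 1: "(\<epsilon> - q) * al = ga / y - \<epsilon> * y * gm"
  assumes 2: "y / q * alm + alp / (q * y) - (1 + \<epsilon>) * al = - (ga - \<epsilon> * gm)"
  assumes rel: "(1 - X' / y) * B = (1 - X * y) * Bp"
  shows "E * al * (X * y * Bp + (1 + X * X') * B + X / y * Bm - (1 + X) * (1 + \<epsilon> * X) * B)
    = E * (X * y * al * Bp - \<epsilon> * (X / (q * y)) * alp * B - \<epsilon> * X * ga * (1 - X * y) * Bp)
    - \<epsilon> * E * (X * (y / q) * alm * B - \<epsilon> * (X / y) * al * Bm - \<epsilon> * X * gm * (1 - X' * y) * B)"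
proof -
  have ee: "\<epsilon> * \<epsilon> = 1" using assms(3) by auto
  have "E * (X * y * al * Bp - \<epsilon> * (X / (q * y)) * alp * B - \<epsilon> * X * ga * (1 - X * y) * Bp)
    - \<epsilon> * E * (X * (y / q) * alm * B - \<epsilon> * (X / y) * al * Bm - \<epsilon> * X * gm * (1 - X' * y) * B)
   = E * (X * y * al * Bp + X / y * al * Bm) * 1
     - \<epsilon> * E * X * B * ((y / q * alm + alp / (q * y) - (1 + \<epsilon>) * al) + (1 + \<epsilon>) * al)
     - \<epsilon> * E * X * ga * ((1 - X * y) * Bp)
     + (\<epsilon> * \<epsilon>) * E * X * gm * (1 - X' * y) * B + (\<epsilon> * \<epsilon> - 1) * E * X / y * al * Bm"
    by (simp add: algebra_simps diff_divide_distrib add_divide_distrib)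
  also have "\<dots> = E * (X * y * al * Bp + X / y * al * Bm)
     + \<epsilon> * E * X * B * (X' * (ga / y - \<epsilon> * y * gm) - (1 + \<epsilon>) * al)"
    unfolding 2 rel[symmetric] ee using assms(3)
    by (elim disjE) (simp_all add: algebra_simps diff_divide_distrib add_divide_distrib)
  also have "\<dots> = E * (X * y * al * Bp + X / y * al * Bm)
     + \<epsilon> * E * X * B * (X' * ((\<epsilon> - q) * al) - (1 + \<epsilon>) * al)"
    by (simp only: 1)
  also have "\<dots> = E * al * (X * y * Bp + (1 + X * X') * B + X / y * Bm - (1 + X) * (1 + \<epsilon> * X) * B)"
    using assms(3) by (elim disjE) (simp_all add: X algebra_simps)
  finally show ?thesis by simp
qed

definition alpha1 :: "complex \<Rightarrow> nat \<Rightarrow> complex" where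
  "alpha1 q r = bailey1_alpha (q ^ (r\<^sup>2)) (q ^ r) (tri_sum q r) (tri_inv q r)"

definition gamma1 :: "complex \<Rightarrow> complex \<Rightarrow> nat \<Rightarrow> complex" where
  "gamma1 \<epsilon> q r = bailey1_cert \<epsilon> q (q ^ (r\<^sup>2)) (q ^ r) (tri_sum q r) (tri_inv q r)"

lemma power_Suc_square: "(x::complex) ^ ((Suc k)\<^sup>2) = x ^ (k\<^sup>2) * x * (x ^ k)\<^sup>2"
  by (simp add: power2_eq_square algebra_simps flip: power_add)

text \<open>Neighbouring values are rewritten through the data at one index, so that the certificate
  relations become applicable to the actual sequences.\<close>

lemma alpha1_shift:
  assumes "q \<noteq> 0"
  defines "G \<equiv> \<lambda>r. q ^ (r\<^sup>2)" and "y \<equiv> \<lambda>r. q ^ r"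
  shows alpha1_Suc: "alpha1 q (Suc r) = bailey1_alpha (G r * q * (y r)\<^sup>2) (q * y r)
      (tri_sum q r + tri_inv q r / (q * y r)) (tri_inv q r / (q * y r))"
    and alpha1_pred: "alpha1 q r = bailey1_alpha (G (Suc r) * q / (y (Suc r))\<^sup>2) (y (Suc r) / q)
      (tri_sum q (Suc r) - tri_inv q (Suc r)) (y (Suc r) * tri_inv q (Suc r))"
    and gamma1_pred: "gamma1 \<epsilon> q r = bailey1_cert \<epsilon> q (G (Suc r) * q / (y (Suc r))\<^sup>2) (y (Suc r) / q)
      (tri_sum q (Suc r) - tri_inv q (Suc r)) (y (Suc r) * tri_inv q (Suc r))"
proof -
  have 1: "y (Suc r) / q = q ^ r" "G (Suc r) * q / (y (Suc r))\<^sup>2 = q ^ (r\<^sup>2)"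
    using assms(1) unfolding G_def y_def power_Suc_square
    by (simp_all add: power2_eq_square)
  have 2: "tri_sum q (Suc r) - tri_inv q (Suc r) = tri_sum q r"
    "y (Suc r) * tri_inv q (Suc r) = tri_inv q r"
    using assms(1) by (simp_all add: tri_sum_def tri_inv_Suc y_def)
  show "alpha1 q r = bailey1_alpha (G (Suc r) * q / (y (Suc r))\<^sup>2) (y (Suc r) / q)
      (tri_sum q (Suc r) - tri_inv q (Suc r)) (y (Suc r) * tri_inv q (Suc r))"
    "gamma1 \<epsilon> q r = bailey1_cert \<epsilon> q (G (Suc r) * q / (y (Suc r))\<^sup>2) (y (Suc r) / q)
      (tri_sum q (Suc r) - tri_inv q (Suc r)) (y (Suc r) * tri_inv q (Suc r))"
    unfolding 1 2 alpha1_def gamma1_def by simp_all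
  show "alpha1 q (Suc r) = bailey1_alpha (G r * q * (y r)\<^sup>2) (q * y r)
      (tri_sum q r + tri_inv q r / (q * y r)) (tri_inv q r / (q * y r))"
    unfolding alpha1_def power_Suc_square G_def y_def
    by (simp add: tri_sum_def tri_inv_Suc)
qed

text \<open>
  The sequence \<open>alpha1\<close> is half of a sequence symmetric under \<open>r \<mapsto> - r\<close>; the central value
  \<open>alpha1 q 0 = 2\<close> is therefore taken with weight one half.
\<close>

definition bailey1 :: "complex \<Rightarrow> complex \<Rightarrow> nat \<Rightarrow> complex" where
  "bailey1 \<epsilon> q n = bweight q 0 n 0 + (\<Sum>r = 1..n. \<epsilon> ^ r * alpha1 q r * bweight q 0 n r)"

text \<open>The neighbouring indices stay integers because \<open>r - 1\<close> is negative at
  \<open>r = 0\<close>; the power with exponent \<open>n + 1 - r\<close> is a quotient to avoid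
  truncated subtraction.\<close>

lemma bweight_rec_nat:
  assumes "q \<noteq> 0" "norm q < 1"
  shows "(1 - q ^ (2 * Suc n + e)) * (1 - q ^ (2 * n + 1 + e)) * bweight q e (Suc n) r
       = q ^ (Suc n + r + e) * bweight q e n (int r + 1)
         + (1 + q ^ (2 * n + 1 + e)) * bweight q e n r
         + q ^ Suc n / q ^ r * bweight q e n (int r - 1)"
proof -
  have "q powi (2 * int (Suc n) + int e) = q ^ (2 * Suc n + e)"
    "q powi (2 * int (Suc n) + int e - 1) = q ^ (2 * n + 1 + e)"
    "q powi (int (Suc n) + int r + int e) = q ^ (Suc n + r + e)"
    by (simp_all add: power_int_def nat_add_distrib nat_mult_distrib)
  moreover have "q powi (int (Suc n) - int r) = q ^ Suc n / q ^ r"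
    using assms(1) by (subst power_int_diff) (simp_all del: of_nat_Suc power_Suc)
  ultimately show ?thesis
    using bweight_rec[OF assms, of "int (Suc n)" "int e" "int r"] by simp
qed

lemma bweight_shift_nat:
  assumes "q \<noteq> 0" "norm q < 1"
  shows "(1 - q ^ n / q ^ r) * bweight q e n r = (1 - q ^ (Suc n + r + e)) * bweight q e n (int r + 1)"
proof -
  have "q powi (int n - int r) = q ^ n / q ^ r"
    using assms(1) by (subst power_int_diff) simp_all
  moreover have "q powi (int n + int r + int e + 1) = q ^ (Suc n + r + e)"
    by (simp add: power_int_def nat_add_distrib)
  ultimately show ?thesis
    using bweight_shift[OF assms(2), of "int n" "int r" "int e"] by simp
qed

text \<open>\<open>bweight_rec\<close> expresses level \<open>n + 1\<close> through weights at level
  \<open>n\<close>; the difference of the two sides is then a telescoping sum in \<open>r\<close>,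
  with both ends accounted for.\<close>

lemma bailey1_rec:
  assumes q: "q \<noteq> 0" "norm q < 1" and \<epsilon>: "\<epsilon> = 1 \<or> \<epsilon> = -1"
  shows "(1 - q ^ (2 * Suc n)) * (1 - q ^ (2 * n + 1)) * bailey1 \<epsilon> q (Suc n)
       = (1 + q ^ Suc n) * (1 + \<epsilon> * q ^ Suc n) * bailey1 \<epsilon> q n"
proof -
  define X X' where "X = q ^ Suc n" and "X' = q ^ n"
  have X: "X = q * X'" by (simp add: X_def X'_def)
  define B where "B = bweight q 0 n"
  define L where "L r = X * q ^ r * B (int r + 1) + (1 + X * X') * B r + X / q ^ r * B (int r - 1)" for r :: nat
  \<comment> \<open>The first two parts are the terms that cross from index \<open>r\<close> to
    \<open>r + 1\<close> and back when the sum is reindexed to collect each weight; the third is the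
    certificate.\<close>
  define \<Gamma> where "\<Gamma> r = \<epsilon> ^ r * (X * q ^ r * alpha1 q r * B (int r + 1)
      - \<epsilon> * (X / (q * q ^ r)) * alpha1 q (Suc r) * B r
      - \<epsilon> * X * gamma1 \<epsilon> q r * (1 - X * q ^ r) * B (int r + 1))" for r :: nat
  have XX': "q ^ (2 * n + 1) = X * X'"
    by (simp add: X_def X'_def mult_2 power_add)
  have L: "(1 - q ^ (2 * Suc n)) * (1 - q ^ (2 * n + 1)) * bweight q 0 (int (Suc n)) r = L r" for r :: nat
    using bweight_rec_nat[OF q, of n 0 r]
    by (simp only: add_0_right of_nat_0 L_def B_def XX' power_add[of q "Suc n" r] X_def[symmetric])
  have rel: "(1 - X' / q ^ r) * B r = (1 - X * q ^ r) * B (int r + 1)" for r :: nat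
    using bweight_shift_nat[OF q, of n r 0] by (simp add: X_def X'_def B_def power_add)
  have cert: "\<epsilon> ^ r * alpha1 q r * (L r - (1 + X) * (1 + \<epsilon> * X) * B r) = \<Gamma> r - \<Gamma> (r - 1)"
    if r: "r \<in> {Suc 0..Suc n}" for r
  proof -
    obtain k where k: "r = Suc k" using r by (cases r) auto
    let ?y = "q ^ r"
    have y: "?y \<noteq> 0" using q by simp
    have ek: "\<epsilon> ^ k = \<epsilon> * \<epsilon> ^ r"
      using \<epsilon> by (auto simp: k)
    have "\<Gamma> (r - 1) = \<epsilon> ^ k * (X * q ^ k * alpha1 q k * B r
      - \<epsilon> * (X / ?y) * alpha1 q r * B (int r - 1)
      - \<epsilon> * X * gamma1 \<epsilon> q k * (1 - X * q ^ k) * B r)"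
      unfolding \<Gamma>_def by (simp add: k add.commute)
    also have "q ^ k = ?y / q" using q by (simp add: k)
    also have "X * (?y / q) = X' * ?y" using q by (simp add: X)
    finally have \<Gamma>': "\<Gamma> (r - 1) = \<epsilon> * \<epsilon> ^ r * (X * (?y / q) * alpha1 q k * B r
      - \<epsilon> * (X / ?y) * alpha1 q r * B (int r - 1)
      - \<epsilon> * X * gamma1 \<epsilon> q k * (1 - X' * ?y) * B r)"
      using q unfolding ek by (simp add: X)
    show ?thesis
      unfolding \<Gamma>' L_def unfolding \<Gamma>_def
      using bailey1_cert_linear[OF q(1) y \<epsilon>, of "q ^ (r\<^sup>2)" "tri_sum q r" "tri_inv q r"]
        bailey1_cert_const[OF q(1) y \<epsilon>, of "q ^ (r\<^sup>2)" "tri_sum q r" "tri_inv q r"]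
      unfolding gamma1_pred[OF q(1), of \<epsilon> k, folded k, symmetric]
        alpha1_pred[OF q(1), of k, folded k, symmetric]
        alpha1_Suc[OF q(1), of r, symmetric]
        alpha1_def[of q r, symmetric] gamma1_def[of \<epsilon> q r, symmetric]
      by (rule bailey1_telescope[OF q(1) y \<epsilon> X _ _ rel])
  qed
  \<comment> \<open>At \<open>r = 0\<close> half of the central value 2 is used; the symmetry
    \<open>B (-1) = B 1\<close> compensates for the missing lower neighbour.\<close>
  have base: "L 0 - (1 + X) * (1 + \<epsilon> * X) * B 0 = \<Gamma> 0"
  proof -
    have Bm: "B (-1) = B 1"
      using bweight_reflect[of q 0 n "1"] by (simp add: B_def)
    have ag: "alpha1 q 0 = 2" "alpha1 q (Suc 0) = q\<^sup>2 + q" "gamma1 \<epsilon> q 0 = \<epsilon> - q"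
      using q by (simp_all add: alpha1_def gamma1_def bailey1_alpha_def bailey1_cert_def tri_sum_def tri_inv_def
          field_simps power2_eq_square)
    have "\<Gamma> 0 = 2 * X * B 1 - \<epsilon> * (X * ((q\<^sup>2 + q) / q)) * B 0 - \<epsilon> * X * (\<epsilon> - q) * ((1 - X) * B 1)"
      unfolding \<Gamma>_def ag by simp
    also have "(1 - X) * B 1 = (1 - X') * B 0"
      using rel[of 0] by simp
    also have "(q\<^sup>2 + q) / q = q + 1"
      using q by (simp add: field_simps power2_eq_square)
    finally have "\<Gamma> 0 = 2 * X * B 1 - \<epsilon> * (X * (q + 1)) * B 0 - \<epsilon> * X * (\<epsilon> - q) * ((1 - X') * B 0)" .
    moreover have "L 0 = 2 * X * B 1 + (1 + X * X') * B 0"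
      by (simp add: L_def Bm)
    ultimately show ?thesis
      using \<epsilon> by (elim disjE) (simp_all add: X algebra_simps)
  qed
  have "(1 - q ^ (2 * Suc n)) * (1 - q ^ (2 * n + 1)) * bailey1 \<epsilon> q (Suc n)
      = L 0 + (\<Sum>r = Suc 0..Suc n. \<epsilon> ^ r * alpha1 q r * L r)"
    unfolding bailey1_def L[symmetric]
    by (simp add: distrib_left sum_distrib_left mult_ac del: sum.cl_ivl_Suc power_Suc of_nat_Suc)
  \<comment> \<open>The sum may run to \<open>Suc n\<close>, since the weight of level
    \<open>n\<close> is 0 there.\<close>
  moreover have "bailey1 \<epsilon> q n = B 0 + (\<Sum>r = Suc 0..Suc n. \<epsilon> ^ r * alpha1 q r * B r)"
    by (simp add: bailey1_def B_def bweight_eq_0)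
  ultimately have "(1 - q ^ (2 * Suc n)) * (1 - q ^ (2 * n + 1)) * bailey1 \<epsilon> q (Suc n)
      - (1 + X) * (1 + \<epsilon> * X) * bailey1 \<epsilon> q n
      = (L 0 - (1 + X) * (1 + \<epsilon> * X) * B 0)
        + (\<Sum>r = Suc 0..Suc n. \<epsilon> ^ r * alpha1 q r * (L r - (1 + X) * (1 + \<epsilon> * X) * B r))"
    by (simp add: algebra_simps sum_subtractf sum_distrib_left del: sum.cl_ivl_Suc power_Suc)
  also have "(\<Sum>r = Suc 0..Suc n. \<epsilon> ^ r * alpha1 q r * (L r - (1 + X) * (1 + \<epsilon> * X) * B r))
      = (\<Sum>r = Suc 0..Suc n. \<Gamma> r - \<Gamma> (r - 1))"
    by (intro sum.cong cert refl)
  also have "\<dots> = \<Gamma> (Suc n) - \<Gamma> 0"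
    by (rule sum_telescope'') simp
  also have "\<Gamma> (Suc n) = 0"
    by (simp add: \<Gamma>_def B_def bweight_eq_0)
  finally show ?thesis
    using base by (simp add: X_def)
qed

lemma bailey1_0: "bailey1 \<epsilon> q 0 = 1"
  by (simp add: bailey1_def bweight_def ipoch_def)

lemma bailey1_plus:
  assumes q: "q \<noteq> 0" "norm q < 1"
  shows "bailey1 1 q n = (qpoch (-q) q n)\<^sup>2 / qpoch q q (2 * n)"
proof (induction n)
  case (Suc n)
  have nz: "1 - q ^ (2 * Suc n) \<noteq> 0" "1 - q ^ (2 * n + 1) \<noteq> 0"
    using one_minus_pow_mult_nonzero[OF q(2) q(2), of "2 * n"]
      one_minus_pow_mult_nonzero[OF q(2) q(2), of "2 * n + 1"] by (simp_all add: mult_ac)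
  have "qpoch q q (2 * Suc n) = qpoch q q (2 * n) * (1 - q ^ (2 * n + 1)) * (1 - q ^ (2 * Suc n))"
    by (simp add: qpoch_Suc mult_ac)
  moreover have "qpoch (-q) q (Suc n) = qpoch (-q) q n * (1 + q ^ Suc n)"
    by (simp add: qpoch_Suc mult_ac)
  moreover have "bailey1 1 q (Suc n) = (1 + q ^ Suc n) * (1 + q ^ Suc n) * bailey1 1 q n
      / ((1 - q ^ (2 * Suc n)) * (1 - q ^ (2 * n + 1)))"
    using bailey1_rec[OF q, of 1 n] nz by (simp only: eq_divide_eq) (simp add: mult_ac del: power_Suc)
  ultimately show ?case
    by (simp only: Suc.IH) (simp add: power2_eq_square mult_ac del: power_Suc)
qed (simp add: bailey1_0)

text \<open>For \<open>\<epsilon> = -1\<close> the factor on the right of the recurrence is 1 -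
  q^(2n+2), which cancels on both sides.\<close>

lemma bailey1_minus:
  assumes q: "q \<noteq> 0" "norm q < 1"
  shows "bailey1 (-1) q n = 1 / qpoch q (q\<^sup>2) n"
proof (induction n)
  case (Suc n)
  have nz: "1 - q ^ (2 * Suc n) \<noteq> 0" "1 - q ^ (2 * n + 1) \<noteq> 0"
    using one_minus_pow_mult_nonzero[OF q(2) q(2), of "2 * n"]
      one_minus_pow_mult_nonzero[OF q(2) q(2), of "2 * n + 1"] by (simp_all add: mult_ac)
  have "(1 - q ^ (2 * Suc n)) * ((1 - q ^ (2 * n + 1)) * bailey1 (-1) q (Suc n))
      = (1 + q ^ Suc n) * (1 - q ^ Suc n) * bailey1 (-1) q n"
    using bailey1_rec[OF q, of "-1" n] by (simp only: mult.assoc) simp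
  also have "(1 + q ^ Suc n) * (1 - q ^ Suc n) = 1 - q ^ (2 * Suc n)"
    by (simp only: power_even_eq) (simp add: algebra_simps power2_eq_square del: power_Suc)
  finally have "bailey1 (-1) q (Suc n) = bailey1 (-1) q n / (1 - q ^ (2 * n + 1))"
    using nz by (simp add: eq_divide_eq mult_ac)
  moreover have "qpoch q (q\<^sup>2) (Suc n) = qpoch q (q\<^sup>2) n * (1 - q ^ (2 * n + 1))"
    by (simp add: qpoch_Suc mult_ac flip: power_mult)
  ultimately show ?case
    by (simp only: Suc.IH) simp
qed (simp add: bailey1_0)

section \<open>The Bailey pair for the third identity\<close>

definition alt_term :: "complex \<Rightarrow> nat \<Rightarrow> complex" where
  "alt_term q m = (-1) ^ m * inverse (q ^ (m\<^sup>2))"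

text \<open>The theta sum of (-1)^m q^(-m^2) over \<open>\<bar>m\<bar> \<le> n\<close>, folded by
  the symmetry under m -> -m.\<close>

definition alt_sum :: "complex \<Rightarrow> nat \<Rightarrow> complex" where
  "alt_sum q n = 1 + 2 * (\<Sum>m = 1..n. alt_term q m)"

text \<open>
  Here \<open>y = q ^ (2 * r)\<close>, \<open>G = q ^ (2 * r\<^sup>2)\<close>, \<open>X = q ^ (2 * n)\<close>, and \<open>T\<close>, \<open>u\<close> stand for \<open>alt_sum q r\<close>,
  \<open>alt_term q r\<close>. The certificate now has a part of degree one in \<open>X\<close>.
\<close>

definition bailey3_alpha :: "complex \<Rightarrow> complex \<Rightarrow> complex \<Rightarrow> complex \<Rightarrow> complex" where
  "bailey3_alpha q G y T = G * (1 - q\<^sup>2 * y\<^sup>2) * T"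

definition bailey3_cert :: "complex \<Rightarrow> complex \<Rightarrow> complex \<Rightarrow> complex \<Rightarrow> complex \<Rightarrow> complex \<Rightarrow> complex" where
  "bailey3_cert q X G y T u =
     G * ((q ^ 6 * y ^ 3 + 2 * q * y\<^sup>2 + q\<^sup>2 * y) * T - (2 * q ^ 5 * y\<^sup>2 + 2 * y) * u)
     + X * q\<^sup>2 * y\<^sup>2 * G
       * ((1 / (q * y) + q ^ 3 * y + 2 * q\<^sup>2) * T - (2 * q / y + 2 * q\<^sup>2) * u)"

text \<open>\<open>am\<close>, \<open>gm\<close> belong to \<open>r - 1\<close> and
  \<open>ap\<close> to \<open>r + 1\<close>, written in the data at \<open>r\<close>. All powers of
  \<open>X\<close> are treated in one identity because the certificate itself depends on
  \<open>X\<close>.\<close>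

lemma bailey3_cert_rel:
  fixes q y X G T u :: complex
  assumes "q \<noteq> 0" "y \<noteq> 0"
  defines "am \<equiv> bailey3_alpha q (G * q\<^sup>2 / y\<^sup>2) (y / q\<^sup>2) (T - 2 * u)"
    and "gm \<equiv> bailey3_cert q X (G * q\<^sup>2 / y\<^sup>2) (y / q\<^sup>2) (T - 2 * u) (- (y / q) * u)"
    and "ap \<equiv> bailey3_alpha q (G * q\<^sup>2 * y\<^sup>2) (q\<^sup>2 * y) (T - 2 * u / (q * y))"
    and "a \<equiv> bailey3_alpha q G y T" and "g \<equiv> bailey3_cert q X G y T u"
  shows "a * (2 / q + X * (1 + q\<^sup>2) + X\<^sup>2 * (1 / q - q)) + (1 + X / q) * (ap / (q\<^sup>2 * y) + y * am)
    = - (g * (1 - X / (q\<^sup>2 * y)) - gm * (1 - X * y))"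
  using assms(1,2) unfolding am_def gm_def ap_def a_def g_def bailey3_alpha_def bailey3_cert_def
  by (simp add: field_simps power2_eq_square power3_eq_cube eval_nat_numeral)

text \<open>The same mechanism as before: \<open>rel\<close> converts the certificate part with
  \<open>Bp\<close> to \<open>B\<close>, and \<open>key\<close> supplies the whole coefficient of
  \<open>B\<close>. The factor \<open>1 + X / q\<close> comes from the left side of the recurrence
  for \<open>bailey3\<close>.\<close>

lemma bailey3_telescope:
  fixes al alp alm ga gm B Bp Bm X y q :: complex
  assumes "q \<noteq> 0" "y \<noteq> 0"
  assumes key: "al * (2 / q + X * (1 + q\<^sup>2) + X\<^sup>2 * (1 / q - q))
      + (1 + X / q) * (alp / (q\<^sup>2 * y) + y * alm)
    = - (ga * (1 - X / (q\<^sup>2 * y)) - gm * (1 - X * y))"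
  assumes rel: "(1 - X / (q\<^sup>2 * y)) * B = (1 - X * q\<^sup>2 * y) * Bp"
  shows "al * ((1 + X / q) * (X * q\<^sup>2 * y * Bp + (1 + X\<^sup>2) * B + X / y * Bm)
      - (1 - X / q) * (1 - X\<^sup>2 * q\<^sup>2) * B)
    = ((1 + X / q) * (X * q\<^sup>2 * y * al * Bp - X / (q\<^sup>2 * y) * alp * B) - X * ga * (1 - X * q\<^sup>2 * y) * Bp)
    - ((1 + X / q) * (X * y * alm * B - X / y * al * Bm) - X * gm * (1 - X * y) * B)"
proof -
  have "((1 + X / q) * (X * q\<^sup>2 * y * al * Bp - X / (q\<^sup>2 * y) * alp * B) - X * ga * (1 - X * q\<^sup>2 * y) * Bp)
    - ((1 + X / q) * (X * y * alm * B - X / y * al * Bm) - X * gm * (1 - X * y) * B)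
    = (1 + X / q) * al * (X * q\<^sup>2 * y * Bp + X / y * Bm)
      - X * ga * ((1 - X * q\<^sup>2 * y) * Bp) + X * gm * (1 - X * y) * B
      - X * B * ((1 + X / q) * (alp / (q\<^sup>2 * y) + y * alm))"
    by (simp add: algebra_simps add_divide_distrib diff_divide_distrib)
  also have "\<dots> = (1 + X / q) * al * (X * q\<^sup>2 * y * Bp + X / y * Bm)
      + X * B * (- (ga * (1 - X / (q\<^sup>2 * y)) - gm * (1 - X * y)))
      - X * B * ((1 + X / q) * (alp / (q\<^sup>2 * y) + y * alm))"
    unfolding rel[symmetric] by (simp add: algebra_simps)
  also have "\<dots> = (1 + X / q) * al * (X * q\<^sup>2 * y * Bp + X / y * Bm)
      + X * B * (al * (2 / q + X * (1 + q\<^sup>2) + X\<^sup>2 * (1 / q - q)))"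
    unfolding key[symmetric] by (simp only: distrib_left diff_conv_add_uminus add.assoc right_minus add_0_right)
  also have "X * B * (al * (2 / q + X * (1 + q\<^sup>2) + X\<^sup>2 * (1 / q - q)))
     = al * ((1 + X / q) * ((1 + X\<^sup>2) * B) - (1 - X / q) * (1 - X\<^sup>2 * q\<^sup>2) * B)"
    using assms(1) by (simp add: field_simps power2_eq_square)
  also have "(1 + X / q) * al * (X * q\<^sup>2 * y * Bp + X / y * Bm)
      + al * ((1 + X / q) * ((1 + X\<^sup>2) * B) - (1 - X / q) * (1 - X\<^sup>2 * q\<^sup>2) * B)
    = al * ((1 + X / q) * (X * q\<^sup>2 * y * Bp + (1 + X\<^sup>2) * B + X / y * Bm)
      - (1 - X / q) * (1 - X\<^sup>2 * q\<^sup>2) * B)"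
    by (simp only: distrib_left distrib_right right_diff_distrib mult_ac add_ac) simp
  finally show ?thesis ..
qed

definition alpha3 :: "complex \<Rightarrow> nat \<Rightarrow> complex" where
  "alpha3 q r = bailey3_alpha q (q ^ (2 * r\<^sup>2)) (q\<^sup>2 ^ r) (alt_sum q r)"

definition gamma3 :: "complex \<Rightarrow> complex \<Rightarrow> nat \<Rightarrow> complex" where
  "gamma3 q X r = bailey3_cert q X (q ^ (2 * r\<^sup>2)) (q\<^sup>2 ^ r) (alt_sum q r) (alt_term q r)"

lemma alt_term_Suc: "alt_term q (Suc r) = - alt_term q r / (q * q\<^sup>2 ^ r)"
  unfolding alt_term_def power_Suc_square
  by (simp add: field_simps power_even_eq flip: power_mult)

lemma alpha3_shift:
  assumes "q \<noteq> 0"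
  defines "G \<equiv> \<lambda>r. q ^ (2 * r\<^sup>2)" and "y \<equiv> \<lambda>r. q\<^sup>2 ^ r"
  shows alpha3_Suc: "alpha3 q (Suc r) = bailey3_alpha q (G r * q\<^sup>2 * (y r)\<^sup>2) (q\<^sup>2 * y r)
      (alt_sum q r - 2 * alt_term q r / (q * y r))"
    and alpha3_pred: "alpha3 q r = bailey3_alpha q (G (Suc r) * q\<^sup>2 / (y (Suc r))\<^sup>2) (y (Suc r) / q\<^sup>2)
      (alt_sum q (Suc r) - 2 * alt_term q (Suc r))"
    and gamma3_pred: "gamma3 q X r = bailey3_cert q X (G (Suc r) * q\<^sup>2 / (y (Suc r))\<^sup>2) (y (Suc r) / q\<^sup>2)
      (alt_sum q (Suc r) - 2 * alt_term q (Suc r)) (- (y (Suc r) / q) * alt_term q (Suc r))"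
proof -
  have GS: "G (Suc r) = G r * q\<^sup>2 * (y r)\<^sup>2"
    unfolding G_def y_def power_even_eq power_Suc_square
    by (simp add: power_mult_distrib flip: power_mult)
  have 1: "y (Suc r) / q\<^sup>2 = q\<^sup>2 ^ r" "G (Suc r) * q\<^sup>2 / (y (Suc r))\<^sup>2 = q ^ (2 * r\<^sup>2)"
    using assms(1) unfolding GS by (simp_all add: y_def G_def power2_eq_square)
  have 2: "alt_sum q (Suc r) - 2 * alt_term q (Suc r) = alt_sum q r"
    "- (y (Suc r) / q) * alt_term q (Suc r) = alt_term q r"
    using assms(1) by (simp_all add: alt_sum_def alt_term_Suc y_def power2_eq_square algebra_simps)
  show "alpha3 q r = bailey3_alpha q (G (Suc r) * q\<^sup>2 / (y (Suc r))\<^sup>2) (y (Suc r) / q\<^sup>2)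
      (alt_sum q (Suc r) - 2 * alt_term q (Suc r))"
    "gamma3 q X r = bailey3_cert q X (G (Suc r) * q\<^sup>2 / (y (Suc r))\<^sup>2) (y (Suc r) / q\<^sup>2)
      (alt_sum q (Suc r) - 2 * alt_term q (Suc r)) (- (y (Suc r) / q) * alt_term q (Suc r))"
    unfolding 1 2 alpha3_def gamma3_def by simp_all
  show "alpha3 q (Suc r) = bailey3_alpha q (G r * q\<^sup>2 * (y r)\<^sup>2) (q\<^sup>2 * y r)
      (alt_sum q r - 2 * alt_term q r / (q * y r))"
    unfolding alpha3_def GS[unfolded G_def] G_def by (simp add: alt_sum_def alt_term_Suc y_def algebra_simps)
qed

definition bailey3 :: "complex \<Rightarrow> nat \<Rightarrow> complex" where
  "bailey3 q n = (\<Sum>r = 0..n. alpha3 q r * bweight (q\<^sup>2) 1 n r)"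

text \<open>The sum telescopes after multiplication by the extra factor 1 - q^(4n+6), which is
  nonzero and is cancelled at the end.\<close>

lemma bailey3_rec:
  assumes q: "q \<noteq> 0" "norm q < 1"
  shows "(1 + q ^ (2 * n + 1)) * (1 - q ^ (4 * Suc n)) * bailey3 q (Suc n)
       = (1 - q ^ (2 * n + 1)) * bailey3 q n"
proof -
  have q2: "q\<^sup>2 \<noteq> 0" "norm (q\<^sup>2) < 1"
    using q norm_pow_mult_less_1[OF q(2) q(2), of 1] by (simp_all add: power2_eq_square)
  define X where "X = q\<^sup>2 ^ Suc n"
  define B where "B = bweight (q\<^sup>2) 1 n"
  define L where "L r = X * q\<^sup>2 * q\<^sup>2 ^ r * B (int r + 1) + (1 + X\<^sup>2) * B r + X / q\<^sup>2 ^ r * B (int r - 1)"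
    for r :: nat
  define \<Gamma> where "\<Gamma> r = (1 + X / q) * (X * q\<^sup>2 * q\<^sup>2 ^ r * alpha3 q r * B (int r + 1)
        - X / (q\<^sup>2 * q\<^sup>2 ^ r) * alpha3 q (Suc r) * B r)
      - X * gamma3 q X r * (1 - X * q\<^sup>2 * q\<^sup>2 ^ r) * B (int r + 1)" for r :: nat
  have XX: "q\<^sup>2 ^ (2 * n + 1 + 1) = X\<^sup>2" "q\<^sup>2 ^ (2 * Suc n + 1) = X\<^sup>2 * q\<^sup>2"
    "q\<^sup>2 ^ (Suc n + r + 1) = X * q\<^sup>2 * q\<^sup>2 ^ r" for r
  proof -
    have "2 * n + 1 + 1 = Suc n * 2" "2 * Suc n + 1 = Suc n * 2 + 1" by simp_all
    then show "q\<^sup>2 ^ (2 * n + 1 + 1) = X\<^sup>2" "q\<^sup>2 ^ (2 * Suc n + 1) = X\<^sup>2 * q\<^sup>2"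
      by (simp_all only: X_def power_mult power_add power_one_right)
    show "q\<^sup>2 ^ (Suc n + r + 1) = X * q\<^sup>2 * q\<^sup>2 ^ r"
      by (simp add: X_def power_add)
  qed
  have L: "(1 - X\<^sup>2 * q\<^sup>2) * (1 - X\<^sup>2) * bweight (q\<^sup>2) 1 (int (Suc n)) r = L r" for r :: nat
    using bweight_rec_nat[OF q2, of n 1 r]
    unfolding XX L_def B_def X_def[symmetric] by simp
  have rel: "(1 - X / (q\<^sup>2 * q\<^sup>2 ^ r)) * B r = (1 - X * q\<^sup>2 * q\<^sup>2 ^ r) * B (int r + 1)" for r :: nat
  proof -
    have "X / (q\<^sup>2 * q\<^sup>2 ^ r) = q\<^sup>2 ^ n / q\<^sup>2 ^ r"
      using q by (simp add: X_def)
    then show ?thesis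
      using bweight_shift_nat[OF q2, of n r 1] unfolding XX B_def by simp
  qed
  have cert: "alpha3 q r * ((1 + X / q) * L r - (1 - X / q) * (1 - X\<^sup>2 * q\<^sup>2) * B r) = \<Gamma> r - \<Gamma> (r - 1)"
    if r: "r \<in> {Suc 0..Suc n}" for r
  proof -
    obtain k where k: "r = Suc k" using r by (cases r) auto
    let ?y = "q\<^sup>2 ^ r"
    have y: "?y \<noteq> 0" using q by simp
    have \<Gamma>': "\<Gamma> (r - 1) = (1 + X / q) * (X * ?y * alpha3 q k * B r
        - X / ?y * alpha3 q r * B (int r - 1))
      - X * gamma3 q X k * (1 - X * ?y) * B r"
      unfolding \<Gamma>_def by (simp add: k mult.assoc add.commute)
    show ?thesis
      unfolding \<Gamma>' L_def unfolding \<Gamma>_def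
      using bailey3_cert_rel[OF q(1) y, where X = X and G = "q ^ (2 * r\<^sup>2)" and T = "alt_sum q r"
          and u = "alt_term q r"]
      unfolding gamma3_pred[OF q(1), of X k, folded k, symmetric]
        alpha3_pred[OF q(1), of k, folded k, symmetric]
        alpha3_Suc[OF q(1), of r, symmetric]
        alpha3_def[of q r, symmetric] gamma3_def[of q X r, symmetric]
      by (rule bailey3_telescope[OF q(1) y _ rel])
  qed
  \<comment> \<open>For \<open>e = 1\<close> the reflection gives \<open>B (-1) = B 0\<close>, so
    \<open>r = 0\<close> enters with full weight.\<close>
  have base: "alpha3 q 0 * ((1 + X / q) * L 0 - (1 - X / q) * (1 - X\<^sup>2 * q\<^sup>2) * B 0) = \<Gamma> 0"
  proof -
    have Bm: "B (-1) = B 0"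
      using bweight_reflect[of "q\<^sup>2" 1 n "0"] by (simp add: B_def)
    have ag: "alpha3 q 0 = 1 - q\<^sup>2" "alpha3 q (Suc 0) = q\<^sup>2 * (1 - q ^ 6) * (1 - 2 / q)"
      "gamma3 q X 0 = q ^ 6 + 2 * q + q\<^sup>2 - 2 * q ^ 5 - 2 + X * (q + q ^ 5 - 2 * q ^ 3)"
      using q by (simp_all add: alpha3_def gamma3_def bailey3_alpha_def bailey3_cert_def alt_sum_def alt_term_def
          field_simps eval_nat_numeral)
    have "\<Gamma> 0 = (1 + X / q) * (X * q\<^sup>2 * (1 - q\<^sup>2) * B 1 - X / q\<^sup>2 * (q\<^sup>2 * (1 - q ^ 6) * (1 - 2 / q)) * B 0)
      - X * (q ^ 6 + 2 * q + q\<^sup>2 - 2 * q ^ 5 - 2 + X * (q + q ^ 5 - 2 * q ^ 3)) * ((1 - X * q\<^sup>2) * B 1)"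
      unfolding \<Gamma>_def ag by simp
    also have "(1 - X * q\<^sup>2) * B 1 = (1 - X / q\<^sup>2) * B 0"
      using rel[of 0] by simp
    also have "(1 + X / q) * (X * q\<^sup>2 * (1 - q\<^sup>2) * B 1 - X / q\<^sup>2 * (q\<^sup>2 * (1 - q ^ 6) * (1 - 2 / q)) * B 0)
      - X * (q ^ 6 + 2 * q + q\<^sup>2 - 2 * q ^ 5 - 2 + X * (q + q ^ 5 - 2 * q ^ 3)) * ((1 - X / q\<^sup>2) * B 0)
      = (1 - q\<^sup>2) * ((1 + X / q) * (X * q\<^sup>2 * B 1 + (1 + X\<^sup>2) * B 0 + X * B 0) - (1 - X / q) * (1 - X\<^sup>2 * q\<^sup>2) * B 0)"
      using q by (simp add: field_simps eval_nat_numeral)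
    finally show ?thesis
      by (simp add: L_def Bm ag)
  qed
  have "(1 + X / q) * ((1 - X\<^sup>2 * q\<^sup>2) * (1 - X\<^sup>2) * bailey3 q (Suc n))
      = (\<Sum>r = 0..Suc n. alpha3 q r * ((1 + X / q) * L r))"
    unfolding bailey3_def L[symmetric]
    by (simp add: sum_distrib_left mult_ac del: sum.cl_ivl_Suc power_Suc of_nat_Suc)
  moreover have "(1 - X / q) * (1 - X\<^sup>2 * q\<^sup>2) * bailey3 q n
      = (\<Sum>r = 0..Suc n. alpha3 q r * ((1 - X / q) * (1 - X\<^sup>2 * q\<^sup>2) * B r))"
    by (simp add: bailey3_def B_def bweight_eq_0 sum_distrib_left mult_ac)
  ultimately have "(1 + X / q) * ((1 - X\<^sup>2 * q\<^sup>2) * (1 - X\<^sup>2) * bailey3 q (Suc n))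
      - (1 - X / q) * (1 - X\<^sup>2 * q\<^sup>2) * bailey3 q n
      = (\<Sum>r = 0..Suc n. alpha3 q r * ((1 + X / q) * L r - (1 - X / q) * (1 - X\<^sup>2 * q\<^sup>2) * B r))"
    by (simp only: right_diff_distrib sum_subtractf)
  also have "\<dots> = \<Gamma> 0 + (\<Sum>r = Suc 0..Suc n. \<Gamma> r - \<Gamma> (r - 1))"
  proof -
    have "(\<Sum>r = Suc 0..Suc n. alpha3 q r * ((1 + X / q) * L r - (1 - X / q) * (1 - X\<^sup>2 * q\<^sup>2) * B r))
        = (\<Sum>r = Suc 0..Suc n. \<Gamma> r - \<Gamma> (r - 1))"
      by (intro sum.cong cert refl)
    then show ?thesis
      using base by (simp add: sum.atLeast_Suc_atMost [of 0 "Suc n"] del: sum.cl_ivl_Suc)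
  qed
  also have "\<dots> = \<Gamma> (Suc n)"
    by (subst sum_telescope'') simp_all
  also have "\<dots> = 0"
    by (simp add: \<Gamma>_def B_def bweight_eq_0)
  finally have "(1 - X\<^sup>2 * q\<^sup>2) * ((1 + X / q) * (1 - X\<^sup>2) * bailey3 q (Suc n))
      = (1 - X\<^sup>2 * q\<^sup>2) * ((1 - X / q) * bailey3 q n)"
    by (simp add: mult_ac)
  moreover have "1 - X\<^sup>2 * q\<^sup>2 \<noteq> 0"
    using one_minus_pow_mult_nonzero[OF q2(2) q2(2), of "2 * Suc n"]
    by (simp only: X_def power_even_eq) simp
  ultimately have "(1 + X / q) * (1 - X\<^sup>2) * bailey3 q (Suc n) = (1 - X / q) * bailey3 q n"
    by simp
  moreover have X: "X = q ^ (2 * Suc n)"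
    by (simp only: X_def power_mult)
  then have "X / q = q ^ (2 * n + 1)"
    using q by simp
  moreover have "4 * Suc n = 2 * Suc n * 2"
    by simp
  then have "X\<^sup>2 = q ^ (4 * Suc n)"
    by (simp only: X power_mult)
  ultimately show ?thesis by simp
qed

text \<open>The initial value is 1, as \<open>alpha3 q 0 = 1 - q\<^sup>2\<close> cancels the weight.
  In the recurrence 1 - q^(4n+4) splits into a factor of (q^2; q^2)_(n+1) and one of (-q;
  q)_(2n+2).\<close>

lemma bailey3_eq:
  assumes q: "q \<noteq> 0" "norm q < 1"
  shows "bailey3 q n = qpoch q (q\<^sup>2) n / (qpoch (q\<^sup>2) (q\<^sup>2) n * qpoch (-q) q (2 * n))"
proof (induction n)
  case 0
  have "1 - q\<^sup>2 \<noteq> 0"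
    using one_minus_pow_mult_nonzero[OF q(2) q(2), of 1] by (simp add: power2_eq_square)
  then show ?case
    by (simp add: bailey3_def alpha3_def bailey3_alpha_def alt_sum_def bweight_def ipoch_def qpoch_def)
next
  case (Suc n)
  have nq: "norm (-q) < 1" using q by simp
  have nz: "1 + q ^ (2 * n + 1) \<noteq> 0" "1 + q ^ (2 * Suc n) \<noteq> 0" "1 - q ^ (2 * Suc n) \<noteq> 0"
    using one_minus_pow_mult_nonzero[OF q(2) nq, of "2 * n"]
      one_minus_pow_mult_nonzero[OF q(2) nq, of "2 * n + 1"]
      one_minus_pow_mult_nonzero[OF q(2) q(2), of "2 * n + 1"] by (simp_all add: mult_ac)
  have e4: "1 - q ^ (4 * Suc n) = (1 - q ^ (2 * Suc n)) * (1 + q ^ (2 * Suc n))"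
  proof -
    have "4 * Suc n = 2 * Suc n + 2 * Suc n" by simp
    then have "q ^ (4 * Suc n) = q ^ (2 * Suc n) * q ^ (2 * Suc n)"
      by (simp only: power_add)
    then show ?thesis by (simp only:) (simp add: algebra_simps del: power_Suc mult_Suc_right)
  qed
  have "qpoch (-q) q (2 * Suc n) = qpoch (-q) q (2 * n) * (1 + q ^ (2 * n + 1)) * (1 + q ^ (2 * Suc n))"
    by (simp add: qpoch_Suc mult_ac)
  moreover have "qpoch q (q\<^sup>2) (Suc n) = qpoch q (q\<^sup>2) n * (1 - q ^ (2 * n + 1))"
    by (simp add: qpoch_Suc mult_ac flip: power_mult)
  moreover have "qpoch (q\<^sup>2) (q\<^sup>2) (Suc n) = qpoch (q\<^sup>2) (q\<^sup>2) n * (1 - q ^ (2 * Suc n))"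
    by (simp only: qpoch_Suc power_mult[of q 2] power_Suc) (simp only: mult_ac)
  moreover have "bailey3 q (Suc n) = (1 - q ^ (2 * n + 1)) * bailey3 q n
      / ((1 + q ^ (2 * n + 1)) * ((1 - q ^ (2 * Suc n)) * (1 + q ^ (2 * Suc n))))"
    using bailey3_rec[OF q, of n] nz unfolding e4
    by (simp only: eq_divide_eq) (simp add: mult_ac del: power_Suc)
  ultimately show ?case
    by (simp only: Suc.IH) (simp add: mult_ac del: power_Suc)
qed

section \<open>Triangular rearrangement and the limiting Bailey lemma\<close>

lemma summable_Suc_square_power:
  fixes \<rho> :: real
  assumes "0 \<le> \<rho>" "\<rho> < 1"
  shows "summable (\<lambda>n. (real (Suc n))\<^sup>2 * \<rho> ^ n)"
proof -
  have "(\<lambda>n. (1 + inverse (real (Suc n)))\<^sup>2 * \<rho>) \<longlonglongrightarrow> (1 + 0)\<^sup>2 * \<rho>"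
    by (intro tendsto_intros LIMSEQ_inverse_real_of_nat)
  then have "eventually (\<lambda>n. (1 + inverse (real (Suc n)))\<^sup>2 * \<rho> < (1 + \<rho>) / 2) sequentially"
    using assms by (intro order_tendstoD(2)) auto
  then obtain N where N: "(1 + inverse (real (Suc n)))\<^sup>2 * \<rho> < (1 + \<rho>) / 2" if "n \<ge> N" for n
    by (auto simp: eventually_sequentially)
  show ?thesis
  proof (rule summable_ratio_test[of "(1 + \<rho>) / 2" N])
    fix n assume "N \<le> n"
    have "real (Suc (Suc n)) = real (Suc n) * (1 + inverse (real (Suc n)))"
      by (simp add: field_simps)
    then have "norm ((real (Suc (Suc n)))\<^sup>2 * \<rho> ^ Suc n)
        = ((1 + inverse (real (Suc n)))\<^sup>2 * \<rho>) * ((real (Suc n))\<^sup>2 * \<rho> ^ n)"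
      using assms by (simp only:) (simp add: power_mult_distrib mult_ac abs_mult)
    also have "\<dots> \<le> (1 + \<rho>) / 2 * ((real (Suc n))\<^sup>2 * \<rho> ^ n)"
      using N[OF \<open>N \<le> n\<close>] assms by (intro mult_right_mono) auto
    finally show "norm ((real (Suc (Suc n)))\<^sup>2 * \<rho> ^ Suc n)
        \<le> (1 + \<rho>) / 2 * norm ((real (Suc n))\<^sup>2 * \<rho> ^ n)"
      using assms by simp
  qed (use assms in simp)
qed

text \<open>Row \<open>n\<close> has \<open>n + 1\<close> entries, so its absolute sum is at most
  \<open>C * (n + 1)\<^sup>2 * \<rho> ^ n\<close> and the double sum converges absolutely. The
  quadrant is mapped onto the triangle bijectively by \<open>(r, s)\<close> ->
  \<open>(r + s, s)\<close>.\<close>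

lemma has_sum_triangle:
  fixes f :: "nat \<Rightarrow> nat \<Rightarrow> complex" and \<rho> :: real
  assumes \<rho>: "0 \<le> \<rho>" "\<rho> < 1"
    and bound: "\<And>n m. m \<le> n \<Longrightarrow> norm (f n m) \<le> C * real (Suc n) * \<rho> ^ n"
  shows "summable (\<lambda>n. \<Sum>m\<le>n. f n m)"
    and "((\<lambda>(r, s). f (r + s) s) has_sum (\<Sum>n. \<Sum>m\<le>n. f n m)) UNIV"
proof -
  have "(\<Sum>m\<le>n. norm (f n m)) \<le> C * ((real (Suc n))\<^sup>2 * \<rho> ^ n)" for n
  proof -
    have "(\<Sum>m\<le>n. norm (f n m)) \<le> real (card {..n}) * (C * real (Suc n) * \<rho> ^ n)"
      by (intro sum_bounded_above bound) auto
    then show ?thesis by (simp add: power2_eq_square mult_ac)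
  qed
  then have sm: "summable (\<lambda>n. \<Sum>m\<le>n. norm (f n m))"
    by (intro summable_comparison_test'[OF summable_mult[OF summable_Suc_square_power[OF \<rho>], of C]])
      (auto simp: sum_nonneg)
  have "(\<lambda>p. norm (case p of (n, m) \<Rightarrow> f n m)) summable_on Sigma UNIV (\<lambda>n. {..n})"
    unfolding Infinite_Sum.abs_summable_on_Sigma_iff using sm
    by (auto intro!: norm_summable_imp_summable_on simp: sum_nonneg)
  then have "(\<lambda>(n, m). f n m) summable_on Sigma UNIV (\<lambda>n. {..n})"
    by (rule Infinite_Sum.abs_summable_summable)
  then obtain S where S: "((\<lambda>(n, m). f n m) has_sum S) (Sigma UNIV (\<lambda>n. {..n}))"
    by (auto simp: summable_on_def)
  have "((\<lambda>n. \<Sum>m\<le>n. f n m) has_sum S) UNIV"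
    by (rule has_sum_SigmaD[OF S]) (auto intro!: has_sum_finiteI)
  then have sums: "(\<lambda>n. \<Sum>m\<le>n. f n m) sums S"
    by (rule has_sum_imp_sums)
  then show "summable (\<lambda>n. \<Sum>m\<le>n. f n m)"
    by (rule sums_summable)
  show "((\<lambda>(r, s). f (r + s) s) has_sum (\<Sum>n. \<Sum>m\<le>n. f n m)) UNIV"
    by (subst has_sum_reindex_bij_witness[where i = "\<lambda>(n, m). (n - m, m)"
          and j = "\<lambda>(r, s). (r + s, s)" and T = "Sigma UNIV (\<lambda>n. {..n})" and h = "\<lambda>(n, m). f n m"])
      (use S sums_unique[OF sums] in auto)
qed

text \<open>Absolute convergence allows the triangle to be summed by columns \<open>s\<close>
  instead of rows \<open>n\<close>.\<close>

lemma sums_triangle_swap: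
  fixes f :: "nat \<Rightarrow> nat \<Rightarrow> complex" and \<rho> :: real
  assumes \<rho>: "0 \<le> \<rho>" "\<rho> < 1"
    and bound: "\<And>n m. m \<le> n \<Longrightarrow> norm (f n m) \<le> C * real (Suc n) * \<rho> ^ n"
    and inner: "\<And>s. (\<lambda>r. f (r + s) s) sums h s"
  shows "h sums (\<Sum>n. \<Sum>m\<le>n. f n m)"
proof -
  have "((\<lambda>(r, s). f (r + s) s) has_sum (\<Sum>n. \<Sum>m\<le>n. f n m)) (UNIV \<times> UNIV)"
    using has_sum_triangle(2)[OF \<rho> bound] by simp
  then have S: "((\<lambda>(s, r). f (r + s) s) has_sum (\<Sum>n. \<Sum>m\<le>n. f n m)) (UNIV \<times> UNIV)"
    by (subst (asm) has_sum_swap) simp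
  \<comment> \<open>Each column inherits unordered summability from the whole, and its value must be
    the sequential limit given by \<open>inner\<close>.\<close>
  have "((\<lambda>r. f (r + s) s) has_sum h s) UNIV" for s
  proof -
    have "(\<lambda>r. f (r + s) s) summable_on UNIV"
      using summable_on_SigmaD1[of "\<lambda>s r. f (r + s) s" UNIV "\<lambda>_. UNIV" s] S
      by (auto simp: summable_on_def)
    then obtain t where t: "((\<lambda>r. f (r + s) s) has_sum t) UNIV"
      by (auto simp: summable_on_def)
    then have "t = h s"
      using has_sum_imp_sums inner sums_unique2 by blast
    with t show ?thesis by simp
  qed
  then have "(h has_sum (\<Sum>n. \<Sum>m\<le>n. f n m)) UNIV"
    by (intro has_sum_SigmaD[OF S]) auto
  then show ?thesis by (rule has_sum_imp_sums)
qed

section \<open>Conjugate Bailey pairs\<close>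

lemma qpoch_inf_split:
  assumes "norm q < 1"
  shows "qpoch_inf x q = qpoch x q m * qpoch_inf (x * q ^ m) q"
proof -
  have "(\<lambda>n. qpoch x q (n + m)) \<longlonglongrightarrow> qpoch_inf x q"
    using qpoch_tendsto[OF assms] by (rule LIMSEQ_ignore_initial_segment)
  moreover have "(\<lambda>n. qpoch x q (n + m)) \<longlonglongrightarrow> qpoch x q m * qpoch_inf (x * q ^ m) q"
    unfolding add.commute[of _ m] qpoch_add by (intro tendsto_intros qpoch_tendsto assms)
  ultimately show ?thesis by (rule LIMSEQ_unique)
qed

lemma qpoch_inf_0: "qpoch_inf 0 q = 1"
  by (simp add: qpoch_inf_def)

lemma ipoch_of_nat: "ipoch q (int k) = inverse (qpoch q q k)"
  by (simp add: ipoch_def)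

lemma bweight_nat:
  "bweight q (int e) (int (r + s)) (int s) = 1 / (qpoch q q r * qpoch q q (2 * s + e + r))"
proof -
  have "int (r + s) + int s + int e = int (2 * s + e + r)" "int (r + s) - int s = int r"
    by simp_all
  then show ?thesis
    unfolding bweight_def by (simp only: ipoch_of_nat) (simp add: field_simps)
qed

text \<open>The limiting q-Gauss sum with \<open>b = 0\<close> and c = q^(2s+1): the denominator (q;
  q)_(2s+r) splits into (q; q)_(2s) (c; q)_r, and (q; q)_(2s) (c; q)_inf is again (q;
  q)_inf.\<close>

lemma conjugate_bailey1:
  assumes q: "q \<noteq> 0" "norm q < 1"
  shows "(\<lambda>r. q ^ ((r + s)\<^sup>2) * bweight q 0 (int (r + s)) (int s)) sums (q ^ (s\<^sup>2) / qpoch_inf q q)"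
proof -
  define c where "c = q * q ^ (2 * s)"
  have c: "norm c < 1"
    using norm_pow_mult_less_1[OF q(2) q(2), of "2 * s"] by (simp add: c_def mult_ac)
  have coeff: "gauss_coeff 0 q r * q ^ r = q ^ (r\<^sup>2)" for r
    by (induction r) (simp_all add: gauss_coeff_def power2_eq_square power_add mult_ac)
  have "q ^ ((r + s)\<^sup>2) * bweight q 0 (int (r + s)) (int s)
      = q ^ (s\<^sup>2) / qpoch q q (2 * s) * gauss_term 0 q c r" for r
  proof -
    have "gauss_coeff 0 q r * c ^ r = q ^ (r\<^sup>2) * q ^ (2 * s * r)"
      by (simp add: c_def power_mult_distrib mult_ac flip: coeff power_mult)
    moreover have "q ^ ((r + s)\<^sup>2) = q ^ (s\<^sup>2) * (q ^ (r\<^sup>2) * q ^ (2 * s * r))"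
      unfolding power_add[symmetric]
      by (rule arg_cong[of _ _ "(^) q"]) (simp add: power2_eq_square algebra_simps)
    ultimately have "q ^ ((r + s)\<^sup>2) = q ^ (s\<^sup>2) * (gauss_coeff 0 q r * c ^ r)"
      by (simp only:)
    then show ?thesis
      using bweight_nat[of q 0 r s]
      by (simp add: gauss_term_def qpoch_add c_def mult_ac)
  qed
  moreover have "(\<lambda>r. q ^ (s\<^sup>2) / qpoch q q (2 * s) * gauss_term 0 q c r)
      sums (q ^ (s\<^sup>2) / qpoch q q (2 * s) * (qpoch_inf (0 * c) q / qpoch_inf c q))"
    by (intro sums_mult gauss_sum q c)
  moreover have "qpoch_inf q q = qpoch q q (2 * s) * qpoch_inf c q"
    unfolding c_def by (rule qpoch_inf_split[OF q(2)])
  ultimately show ?thesis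
    by (simp add: qpoch_inf_0 mult_ac)
qed

text \<open>The q-Gauss sum in base Q = q^2 with c = Q^(2s+2) and 1/b = Q^(s+1), the latter because
  (Q; Q)_(r+s) = (Q; Q)_s (Q^(s+1); Q)_r. Since bc = Q^(s+1), both infinite products complete to (Q;
  Q)_inf and cancel.\<close>

lemma conjugate_bailey3:
  assumes q: "q \<noteq> 0" "norm q < 1"
  shows "(\<lambda>r. (-1) ^ (r + s) * q ^ ((r + s)\<^sup>2 + (r + s)) * qpoch (q\<^sup>2) (q\<^sup>2) (r + s)
      * bweight (q\<^sup>2) 1 (int (r + s)) (int s)) sums ((-1) ^ s * q ^ (s\<^sup>2 + s))"
proof -
  define Q where "Q = q\<^sup>2"
  have Q: "Q \<noteq> 0" "norm Q < 1"
    using q norm_pow_mult_less_1[OF q(2) q(2), of 1] by (simp_all add: Q_def power2_eq_square)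
  define c where "c = Q * Q ^ (2 * s + 1)"
  define b where "b = 1 / (Q * Q ^ s)"
  have c: "norm c < 1"
    using norm_pow_mult_less_1[OF Q(2) Q(2), of "2 * s + 1"] by (simp add: c_def mult_ac)
  have bc: "b * c = Q * Q ^ s"
    using Q by (simp add: b_def c_def mult_2 power_add)
  have c': "c = Q * Q * Q ^ s * Q ^ s"
    by (simp add: c_def mult_2 power_add)
  have nz: "qpoch Q Q n \<noteq> 0" for n
    by (rule qpoch_nonzero[OF Q(2) Q(2)])
  have coeff: "gauss_coeff b Q r * c ^ r * qpoch Q Q s = (-1) ^ r * q ^ (r\<^sup>2 + r + 2 * r * s) * qpoch Q Q (r + s)" for r
  proof (induction r)
    case (Suc r)
    have "gauss_coeff b Q (Suc r) * c ^ Suc r * qpoch Q Q s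
        = Q ^ r * (Q ^ r * c - b * c) * (gauss_coeff b Q r * c ^ r * qpoch Q Q s)"
      by (simp add: gauss_coeff_def algebra_simps)
    also have "Q ^ r * (Q ^ r * c - b * c) = - (Q ^ r * Q * Q ^ s * (1 - Q ^ (r + s) * Q))"
      unfolding bc unfolding c' by (simp add: power_add algebra_simps)
    also have "Q ^ r * Q * Q ^ s = q ^ (2 * r + 2 + 2 * s)"
      by (simp only: Q_def power_add power_mult)
    also have "- (q ^ (2 * r + 2 + 2 * s) * (1 - Q ^ (r + s) * Q))
        * (gauss_coeff b Q r * c ^ r * qpoch Q Q s)
        = (-1) ^ Suc r * (q ^ (2 * r + 2 + 2 * s) * q ^ (r\<^sup>2 + r + 2 * r * s)) * qpoch Q Q (Suc r + s)"
      unfolding Suc.IH by (simp add: qpoch_Suc mult_ac)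
    also have "q ^ (2 * r + 2 + 2 * s) * q ^ (r\<^sup>2 + r + 2 * r * s) = q ^ ((Suc r)\<^sup>2 + Suc r + 2 * Suc r * s)"
      unfolding power_add[symmetric] by (rule arg_cong[of _ _ "(^) q"]) (simp add: power2_eq_square algebra_simps)
    finally show ?case .
  qed (simp add: gauss_coeff_def)
  have "(-1) ^ (r + s) * q ^ ((r + s)\<^sup>2 + (r + s)) * qpoch Q Q (r + s) * bweight Q 1 (int (r + s)) (int s)
      = (-1) ^ s * q ^ (s\<^sup>2 + s) * qpoch Q Q s / qpoch Q Q (2 * s + 1) * gauss_term b Q c r" for r
  proof -
    have "q ^ ((r + s)\<^sup>2 + (r + s)) = q ^ (s\<^sup>2 + s) * q ^ (r\<^sup>2 + r + 2 * r * s)"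
      unfolding power_add[symmetric] by (rule arg_cong[of _ _ "(^) q"]) (simp add: power2_eq_square algebra_simps)
    then have "(-1) ^ (r + s) * q ^ ((r + s)\<^sup>2 + (r + s)) * qpoch Q Q (r + s)
        = (-1) ^ s * q ^ (s\<^sup>2 + s) * ((-1) ^ r * q ^ (r\<^sup>2 + r + 2 * r * s) * qpoch Q Q (r + s))"
      by (simp only: power_add[of "-1"] mult_ac)
    also have "\<dots> = (-1) ^ s * q ^ (s\<^sup>2 + s) * (gauss_coeff b Q r * c ^ r * qpoch Q Q s)"
      by (simp only: coeff)
    finally have *: "(-1) ^ (r + s) * q ^ ((r + s)\<^sup>2 + (r + s)) * qpoch Q Q (r + s) = \<dots>" .
    have "bweight Q 1 (int (r + s)) (int s)
        = 1 / (qpoch Q Q r * (qpoch Q Q (2 * s + 1) * qpoch c Q r))"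
      using bweight_nat[of Q 1 r s] by (simp only: of_nat_1 qpoch_add[of Q Q "2 * s + 1" r] c_def)
    then show ?thesis
      unfolding * gauss_term_def by (simp only:) (simp add: mult_ac)
  qed
  moreover have "(\<lambda>r. (-1) ^ s * q ^ (s\<^sup>2 + s) * qpoch Q Q s / qpoch Q Q (2 * s + 1) * gauss_term b Q c r)
      sums ((-1) ^ s * q ^ (s\<^sup>2 + s) * qpoch Q Q s / qpoch Q Q (2 * s + 1) * (qpoch_inf (b * c) Q / qpoch_inf c Q))"
    by (intro sums_mult gauss_sum Q c)
  moreover have "qpoch Q Q s * qpoch_inf (b * c) Q = qpoch Q Q (2 * s + 1) * qpoch_inf c Q"
    unfolding c_def bc[unfolded c_def]
    by (simp only: qpoch_inf_split[OF Q(2), of Q s, symmetric] qpoch_inf_split[OF Q(2), of Q "2 * s + 1", symmetric])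
  then have "qpoch Q Q s / qpoch Q Q (2 * s + 1) * (qpoch_inf (b * c) Q / qpoch_inf c Q) = 1"
    using nz qpoch_inf_nonzero[OF Q(2) c] by (simp add: field_simps)
  ultimately show ?thesis
    unfolding Q_def[symmetric] by (simp only: times_divide_eq_right[symmetric] mult.assoc mult_1_right)
qed

section \<open>Growth bounds and the interchange of summations\<close>

lemma norm_pow_le:
  fixes q :: complex
  assumes "norm q < 1" "m \<le> k"
  shows "norm (q ^ k) \<le> norm q ^ m"
  using assms by (simp add: norm_power power_decreasing)

lemma bweight_bounded:
  assumes "norm q < 1"
  obtains K where "K > 0" "\<And>e n r. norm (bweight q e n r) \<le> K"
proof -
  obtain K where K: "K > 0" "\<And>n. norm (inverse (qpoch q q n)) \<le> K"
    using inverse_qpoch_bounded[OF assms assms] by blast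
  have "norm (ipoch q k) \<le> K" for k
    using K by (auto simp: ipoch_def simp del: norm_inverse intro: less_imp_le)
  then have "norm (bweight q e n r) \<le> K * K" for e n r
    unfolding bweight_def norm_mult using K by (intro mult_mono) auto
  with that[of "K * K"] K show ?thesis by simp
qed

lemma norm_tri_sum_le:
  assumes "q \<noteq> 0" "norm q < 1"
  shows "norm (tri_sum q m) \<le> real (Suc m) * norm (tri_inv q m)"
proof -
  have "norm (tri_inv q k) \<le> norm (tri_inv q m)" if "k \<le> m" for k
  proof -
    have "k * (k + 1) div 2 \<le> m * (m + 1) div 2"
      using that by (intro div_le_mono mult_mono) auto
    then have "norm q ^ (m * (m + 1) div 2) \<le> norm q ^ (k * (k + 1) div 2)"
      using assms by (intro power_decreasing) auto
    then show ?thesis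
      using assms unfolding tri_inv_def norm_inverse norm_power
      by (intro le_imp_inverse_le) auto
  qed
  then have "norm (tri_sum q m) \<le> (\<Sum>k\<le>m. norm (tri_inv q m))"
    unfolding tri_sum_def by (intro sum_norm_le) auto
  then show ?thesis by simp
qed

text \<open>The growth of \<open>tri_sum\<close> is offset by q^(m^2): the remaining exponent m^2 -
  m(m+1)/2 - m equals (m-1)(m-2)/2 - 1, hence is at least -1. This explains the factor
  \<open>1 / norm q\<close>.\<close>

lemma norm_alpha1_le:
  assumes q: "q \<noteq> 0" "norm q < 1"
  shows "norm (alpha1 q m) \<le> 4 / norm q * real (Suc m)"
proof -
  define \<rho> \<tau> where "\<rho> = norm q" and "\<tau> = norm (tri_inv q m)"
  have \<rho>: "0 < \<rho>" "\<rho> < 1" using q by (auto simp: \<rho>_def)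
  let ?S = "tri_sum q m" and ?t = "tri_inv q m" and ?y = "q ^ m"
  have S: "norm ?S \<le> real (Suc m) * \<tau>"
    unfolding \<tau>_def by (rule norm_tri_sum_le[OF q])
  have y: "norm ?y \<le> 1" "0 < norm ?y"
    using q by (auto simp: norm_power power_le_one)
  have "norm (?S - ?t - ?y * ?t) \<le> norm ?S + \<tau> + 1 * \<tau>"
    using norm_triangle_ineq4[of "?S - ?t" "?y * ?t"] norm_triangle_ineq4[of ?S ?t] y(1)
      mult_right_mono[OF y(1), of \<tau>] by (simp add: \<tau>_def norm_mult)
  then have *: "norm (?S - ?t - ?y * ?t) \<le> real (Suc m) * \<tau> + 2 * \<tau>"
    using S by simp
  have "norm (?y * ?S) \<le> 1 * norm ?S"
    unfolding norm_mult using y by (intro mult_right_mono) auto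
  also have "\<dots> \<le> norm ?S / norm ?y"
    using y by (simp add: le_divide_eq mult_left_le)
  finally have "norm (?y * ?S) \<le> real (Suc m) * \<tau> / norm ?y"
    using divide_right_mono[OF S, of "norm ?y"] y by simp
  moreover have "norm ((?S - ?t - ?y * ?t) / ?y) \<le> (real (Suc m) * \<tau> + 2 * \<tau>) / norm ?y"
    unfolding norm_divide using * y by (intro divide_right_mono) auto
  ultimately have "norm (?y * ?S - (?S - ?t - ?y * ?t) / ?y)
      \<le> real (Suc m) * \<tau> / norm ?y + (real (Suc m) * \<tau> + 2 * \<tau>) / norm ?y"
    using norm_triangle_ineq4[of "?y * ?S" "(?S - ?t - ?y * ?t) / ?y"] by linarith
  also have "\<dots> = (\<tau> / norm ?y) * (2 * real (Suc m) + 2)"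
    by (simp add: add_divide_distrib algebra_simps)
  also have "\<dots> \<le> (\<tau> / norm ?y) * (4 * real (Suc m))"
    by (intro mult_left_mono) (auto simp: \<tau>_def)
  finally have "norm (alpha1 q m) \<le> norm (q ^ (m\<^sup>2)) * ((\<tau> / norm ?y) * (4 * real (Suc m)))"
    unfolding alpha1_def bailey1_alpha_def norm_mult by (intro mult_left_mono) auto
  also have "\<dots> = (norm (q ^ (m\<^sup>2)) * (\<tau> / norm ?y)) * (4 * real (Suc m))"
    by simp
  also have "norm (q ^ (m\<^sup>2)) * (\<tau> / norm ?y) \<le> 1 / \<rho>"
  proof -
    have "m * (m + 1) div 2 + m \<le> m\<^sup>2 + 1"
    proof -
      have "0 \<le> (int m - 1) * (int m - 2)"
        by (cases "m = 0 \<or> m = 1") auto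
      then have "m * (m + 1) + 2 * m \<le> 2 * (m\<^sup>2 + 1)"
        unfolding of_nat_le_iff[where 'a = int, symmetric]
        by (simp add: algebra_simps power2_eq_square)
      moreover have "2 * (m * (m + 1) div 2) \<le> m * (m + 1)"
        by (rule times_div_less_eq_dividend)
      moreover have "T + m \<le> S + 1" if "P + 2 * m \<le> 2 * (S + 1)" "2 * T \<le> P" for P T S :: nat
        using that by presburger
      ultimately show ?thesis by blast
    qed
    then have "\<rho> ^ (m\<^sup>2 + 1) \<le> \<rho> ^ (m * (m + 1) div 2 + m)"
      using \<rho> by (intro power_decreasing) auto
    then show ?thesis
      using \<rho> unfolding \<tau>_def tri_inv_def norm_inverse norm_power \<rho>_def[symmetric]
      by (simp add: field_simps power_add)
  qed
  then have "(norm (q ^ (m\<^sup>2)) * (\<tau> / norm ?y)) * (4 * real (Suc m)) \<le> 1 / \<rho> * (4 * real (Suc m))"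
    by (intro mult_right_mono) auto
  finally show ?thesis by (simp add: \<rho>_def)
qed

text \<open>The theta sum grows at most like (m+1) |q|^(-m^2), and the prefactor q^(2m^2) outweighs
  it.\<close>

lemma norm_alpha3_le:
  assumes q: "q \<noteq> 0" "norm q < 1"
  shows "norm (alpha3 q m) \<le> 4 * real (Suc m)"
proof -
  define \<rho> where "\<rho> = norm q"
  have \<rho>: "0 < \<rho>" "\<rho> < 1" using q by (auto simp: \<rho>_def)
  have "norm (alt_term q k) \<le> inverse (\<rho> ^ (m\<^sup>2))" if "k \<in> {1..m}" for k
  proof -
    have "k\<^sup>2 \<le> m\<^sup>2" using that by (intro power_mono) auto
    then have "\<rho> ^ (m\<^sup>2) \<le> \<rho> ^ (k\<^sup>2)"
      using \<rho> by (intro power_decreasing) auto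
    then show ?thesis
      using \<rho> unfolding alt_term_def norm_mult norm_inverse norm_power \<rho>_def[symmetric]
      by (simp add: le_imp_inverse_le)
  qed
  then have "norm (\<Sum>k = 1..m. alt_term q k) \<le> (\<Sum>k = 1..m. inverse (\<rho> ^ (m\<^sup>2)))"
    by (rule sum_norm_le)
  moreover have "norm (alt_sum q m) \<le> 1 + 2 * norm (\<Sum>k = 1..m. alt_term q k)"
    unfolding alt_sum_def using norm_triangle_ineq[of 1 "2 * (\<Sum>k = 1..m. alt_term q k)"]
    by (simp add: norm_mult)
  moreover have "1 \<le> inverse (\<rho> ^ (m\<^sup>2))"
    using \<rho> by (intro one_le_inverse) (auto simp: power_le_one)
  ultimately have "norm (alt_sum q m) \<le> 2 * real (Suc m) * inverse (\<rho> ^ (m\<^sup>2))"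
    by (simp add: algebra_simps)
  moreover have "norm (1 - q\<^sup>2 * (q\<^sup>2 ^ m)\<^sup>2) \<le> 2"
  proof -
    have "q\<^sup>2 * (q\<^sup>2 ^ m)\<^sup>2 = q ^ (2 + 2 * m * 2)"
      by (simp only: power_add power_mult)
    moreover have "norm (q ^ (2 + 2 * m * 2)) \<le> 1"
      using norm_pow_le[OF q(2) le0] by (simp only: power_0)
    ultimately have "norm (q\<^sup>2 * (q\<^sup>2 ^ m)\<^sup>2) \<le> 1"
      by (simp only:)
    then show ?thesis
      using norm_triangle_ineq4[of 1 "q\<^sup>2 * (q\<^sup>2 ^ m)\<^sup>2"] by simp
  qed
  ultimately have "norm (alpha3 q m) \<le> \<rho> ^ (2 * m\<^sup>2) * 2 * (2 * real (Suc m) * inverse (\<rho> ^ (m\<^sup>2)))"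
    unfolding alpha3_def bailey3_alpha_def norm_mult norm_power[of q] \<rho>_def[symmetric]
    using \<rho> by (intro mult_mono) auto
  also have "\<dots> = 4 * real (Suc m) * \<rho> ^ (m\<^sup>2)"
  proof -
    have "\<rho> ^ (2 * m\<^sup>2) = \<rho> ^ (m\<^sup>2) * \<rho> ^ (m\<^sup>2)"
      by (simp only: mult_2 power_add)
    then show ?thesis using \<rho> by (simp add: field_simps)
  qed
  also have "\<dots> \<le> 4 * real (Suc m) * 1"
    using \<rho> by (intro mult_left_mono power_le_one) auto
  finally show ?thesis by simp
qed

text \<open>The Bailey lemma in the limit: the sum over the triangle is taken by columns, each
  evaluated by \<open>conjugate_bailey1\<close>. The value 1 at \<open>m = 0\<close> is the halved
  central value of \<open>alpha1\<close>.\<close>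

lemma bailey_limit1:
  assumes q: "q \<noteq> 0" "norm q < 1" and \<epsilon>: "\<epsilon> = 1 \<or> \<epsilon> = -1"
  shows "(\<lambda>m. (if m = 0 then 1 else \<epsilon> ^ m * alpha1 q m) * (q ^ (m\<^sup>2) / qpoch_inf q q))
    sums (\<Sum>n. q ^ (n\<^sup>2) * bailey1 \<epsilon> q n)"
proof -
  obtain K where K: "K > 0" "\<And>e n r. norm (bweight q e n r) \<le> K"
    using bweight_bounded[OF q(2)] by blast
  define \<alpha> where "\<alpha> m = (if m = 0 then 1 else \<epsilon> ^ m * alpha1 q m)" for m
  define f where "f n m = \<alpha> m * (q ^ (n\<^sup>2) * bweight q 0 (int n) (int m))" for n m
  have ne: "norm (\<epsilon> ^ m) = 1" for m
    using \<epsilon> by (auto simp: norm_power)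
  have \<alpha>0: "norm (\<alpha> m) \<le> 4 / norm q * real (Suc m)" for m
    using norm_alpha1_le[OF q, of m] q by (auto simp: \<alpha>_def norm_mult ne le_divide_eq)
  have \<alpha>: "norm (\<alpha> m) \<le> 4 / norm q * real (Suc n)" if "m \<le> n" for m n
    by (rule order_trans[OF \<alpha>0]) (use that in \<open>intro mult_left_mono, auto\<close>)
  have bound: "norm (f n m) \<le> (4 / norm q * K) * real (Suc n) * norm q ^ n" if "m \<le> n" for n m
  proof -
    have "norm (f n m) \<le> (4 / norm q * real (Suc n)) * (norm q ^ n * K)"
      unfolding f_def norm_mult using K(1)
      by (intro mult_mono \<alpha> that norm_pow_le q K) (auto simp: power2_nat_le_imp_le le_square power2_eq_square)
    then show ?thesis by (simp add: mult_ac)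
  qed
  have "(\<lambda>r. f (r + s) s) sums (\<alpha> s * (q ^ (s\<^sup>2) / qpoch_inf q q))" for s
    unfolding f_def by (intro sums_mult conjugate_bailey1 q)
  then have "(\<lambda>m. \<alpha> m * (q ^ (m\<^sup>2) / qpoch_inf q q)) sums (\<Sum>n. \<Sum>m\<le>n. f n m)"
    using q by (intro sums_triangle_swap[where \<rho> = "norm q", OF _ _ bound]) auto
  moreover have "(\<Sum>m\<le>n. f n m) = q ^ (n\<^sup>2) * bailey1 \<epsilon> q n" for n
  proof -
    have "(\<Sum>m\<le>n. f n m) = f n 0 + (\<Sum>m = Suc 0..n. f n m)"
      by (simp add: atMost_atLeast0 sum.atLeast_Suc_atMost)
    also have "(\<Sum>m = Suc 0..n. f n m) = (\<Sum>m = 1..n. q ^ (n\<^sup>2) * (\<epsilon> ^ m * alpha1 q m * bweight q 0 n m))"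
      by (intro sum.cong) (auto simp: f_def \<alpha>_def)
    finally show ?thesis
      by (simp add: bailey1_def f_def \<alpha>_def distrib_left sum_distrib_left)
  qed
  ultimately show ?thesis by (simp add: \<alpha>_def)
qed

lemma bailey_limit3:
  assumes q: "q \<noteq> 0" "norm q < 1"
  shows "(\<lambda>m. alpha3 q m * ((-1) ^ m * q ^ (m\<^sup>2 + m)))
    sums (\<Sum>n. (-1) ^ n * q ^ (n\<^sup>2 + n) * qpoch (q\<^sup>2) (q\<^sup>2) n * bailey3 q n)"
proof -
  have q2: "norm (q\<^sup>2) < 1"
    using norm_pow_mult_less_1[OF q(2) q(2), of 1] by (simp add: power2_eq_square)
  obtain K where K: "K > 0" "\<And>e n r. norm (bweight (q\<^sup>2) e n r) \<le> K"
    using bweight_bounded[OF q2] by blast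
  obtain K' where K': "K' > 0" "\<And>n. norm (qpoch (q\<^sup>2) (q\<^sup>2) n) \<le> K'"
    using qpoch_bounded[OF q2] by blast
  define f where "f n m = alpha3 q m * ((-1) ^ n * q ^ (n\<^sup>2 + n) * qpoch (q\<^sup>2) (q\<^sup>2) n
      * bweight (q\<^sup>2) 1 (int n) (int m))" for n m
  have \<alpha>: "norm (alpha3 q m) \<le> 4 * real (Suc n)" if "m \<le> n" for m n
    using norm_alpha3_le[OF q, of m] that by simp
  have bound: "norm (f n m) \<le> (4 * K' * K) * real (Suc n) * norm q ^ n" if "m \<le> n" for n m
  proof -
    have "norm (f n m) \<le> (4 * real (Suc n)) * (1 * norm q ^ n * K' * K)"
      unfolding f_def norm_mult using K(1) K'(1)
      by (intro mult_mono \<alpha> that norm_pow_le q K K') (auto simp: norm_power)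
    then show ?thesis by (simp add: mult_ac)
  qed
  have "(\<lambda>r. f (r + s) s) sums (alpha3 q s * ((-1) ^ s * q ^ (s\<^sup>2 + s)))" for s
    unfolding f_def by (intro sums_mult conjugate_bailey3 q)
  then have "(\<lambda>m. alpha3 q m * ((-1) ^ m * q ^ (m\<^sup>2 + m))) sums (\<Sum>n. \<Sum>m\<le>n. f n m)"
    using q by (intro sums_triangle_swap[where \<rho> = "norm q", OF _ _ bound]) auto
  moreover have "(\<Sum>m\<le>n. f n m) = (-1) ^ n * q ^ (n\<^sup>2 + n) * qpoch (q\<^sup>2) (q\<^sup>2) n * bailey3 q n" for n
    by (simp add: bailey3_def f_def sum_distrib_left atMost_atLeast0 mult_ac)
  ultimately show ?thesis by simp
qed

section \<open>Indefinite double sums\<close>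

lemma norm_powi_le:
  fixes q :: complex
  assumes "norm q < 1" "int n \<le> e"
  shows "norm (q powi e) \<le> norm q ^ n"
proof -
  have "e = int (nat e)" "n \<le> nat e" using assms by auto
  then show ?thesis
    using norm_pow_le[OF assms(1)] by (metis power_int_of_nat)
qed

lemma two_tri_int: "2 * (m * (m + 1) div 2) = m * (m + 1)" for m :: int
  by (rule dvd_mult_div_cancel) auto

lemma two_binom2: "2 * binom2 r = r * (r - 1)"
  unfolding binom2_def by (rule dvd_mult_div_cancel) auto

lemma infsum_nonneg_quadrant:
  fixes g :: "int \<Rightarrow> int \<Rightarrow> complex"
  assumes "((\<lambda>(r, s). g (int r) (int s)) has_sum A) UNIV"
  shows "(\<Sum>\<^sub>\<infinity>(r, s)\<in>{0..} \<times> {0..}. g r s) = A"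
proof (rule infsumI)
  show "((\<lambda>(r, s). g r s) has_sum A) ({0..} \<times> {0..})"
    by (subst has_sum_reindex_bij_witness[where j = "\<lambda>(r, s). (nat r, nat s)"
          and i = "\<lambda>(r, s). (int r, int s)" and T = UNIV
          and h = "\<lambda>(r, s). g (int r) (int s)"])
      (use assms in auto)
qed

lemma infsum_neg_quadrant:
  fixes g :: "int \<Rightarrow> int \<Rightarrow> complex"
  assumes "((\<lambda>(r, s). g (- 1 - int r) (- 1 - int s)) has_sum A) UNIV"
  shows "(\<Sum>\<^sub>\<infinity>(r, s)\<in>{..<0} \<times> {..<0}. g r s) = A"
proof (rule infsumI)
  show "((\<lambda>(r, s). g r s) has_sum A) ({..<0} \<times> {..<0})"
    by (subst has_sum_reindex_bij_witness[where j = "\<lambda>(r, s). (nat (- 1 - r), nat (- 1 - s))"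
          and i = "\<lambda>(r, s). (- 1 - int r, - 1 - int s)" and T = UNIV
          and h = "\<lambda>(r, s). g (- 1 - int r) (- 1 - int s)"])
      (use assms in auto)
qed

lemma sum_int_atMost: "(\<Sum>m = 0..int n. g m) = (\<Sum>m\<le>n. g (int m))"
  by (rule sum.reindex_bij_witness[of _ int nat]) auto

section \<open>The double sums of the first two identities\<close>

lemma dsum_term_unit:
  assumes "q \<noteq> 0" and \<delta>: "\<delta> = 1 \<or> \<delta> = -1"
  shows "dsum_term a b c (\<delta> * q ^ k) (\<delta> * q ^ l) q r s
    = (- \<delta>) powi (r + s) * q powi (int k * r + int l * s + (a * binom2 r + b * r * s + c * binom2 s))"
proof -
  have "\<delta> \<noteq> 0" using \<delta> by auto
  have 1: "(-1) powi (r + s) * (\<delta> powi r * \<delta> powi s) = (- \<delta>) powi (r + s)"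
    using power_int_mult_distrib[of "-1" \<delta> "r + s"] power_int_add[of \<delta> r s] \<open>\<delta> \<noteq> 0\<close> by simp
  have 2: "q powi (int k * r + int l * s + (a * binom2 r + b * r * s + c * binom2 s))
      = (q ^ k) powi r * (q ^ l) powi s * q powi (a * binom2 r + b * r * s + c * binom2 s)"
    using assms(1) by (simp add: power_int_add power_int_mult)
  show ?thesis
    unfolding dsum_term_def power_int_mult_distrib 1[symmetric] 2 by (simp only: mult_ac)
qed

definition hecke_term :: "complex \<Rightarrow> complex \<Rightarrow> nat \<Rightarrow> nat \<Rightarrow> complex" where
  "hecke_term \<epsilon> q n m = \<epsilon> ^ n * q powi (2 * (int n)\<^sup>2 + int n - int m * (int m + 1) div 2)"

lemma hecke_term_eq:
  assumes "q \<noteq> 0"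
  shows "hecke_term \<epsilon> q n m = \<epsilon> ^ n * q ^ (2 * n\<^sup>2 + n) * tri_inv q m"
proof -
  have e: "2 * (int n)\<^sup>2 + int n - int m * (int m + 1) div 2
      = int (2 * n\<^sup>2 + n) - int (m * (m + 1) div 2)"
    by (simp add: zdiv_int algebra_simps)
  have "q powi (int (2 * n\<^sup>2 + n) - int (m * (m + 1) div 2)) = q ^ (2 * n\<^sup>2 + n) * tri_inv q m"
    using assms by (subst power_int_diff) (simp_all only: power_int_of_nat tri_inv_def divide_inverse simp_thms)
  then show ?thesis
    unfolding hecke_term_def e by (simp only: mult.assoc)
qed

text \<open>For \<open>m \<le> n\<close> the subtracted triangular number is at most n(n+1)/2, hence
  at most n^2, so the exponent is at least \<open>n\<close>.\<close>

lemma norm_hecke_term_le: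
  assumes "q \<noteq> 0" "norm q < 1" "\<epsilon> = 1 \<or> \<epsilon> = -1" "m \<le> n"
  shows "norm (hecke_term \<epsilon> q n m) \<le> norm q ^ n"
proof -
  have "int m * (int m + 1) \<le> int n * (int n + 1)"
    using assms(4) by (intro mult_mono) auto
  moreover have "int n \<le> int n * int n"
    by (cases n) auto
  ultimately have "int n \<le> 2 * (int n)\<^sup>2 + int n - int m * (int m + 1) div 2"
    using two_tri_int[of "int m"] by (simp add: power2_eq_square algebra_simps)
  from norm_powi_le[OF assms(2) this] show ?thesis
    using assms(3) by (auto simp: hecke_term_def norm_mult norm_power)
qed

text \<open>With \<open>n = r + s\<close> and \<open>m = s\<close> the quadratic forms agree.
  Reflecting both indices by r -> -1 - r changes the exponent by exactly \<open>6 * n + 6\<close>,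
  which produces the factor \<open>1 - q ^ (6 * n + 6)\<close>.\<close>

lemma dsum_term_hecke:
  assumes "q \<noteq> 0" and \<epsilon>: "\<epsilon> = 1 \<or> \<epsilon> = -1"
  shows "dsum_term 4 4 3 (- \<epsilon> * q ^ 3) (- \<epsilon> * q ^ 2) q (int r) (int s) = hecke_term \<epsilon> q (r + s) s"
    and "dsum_term 4 4 3 (- \<epsilon> * q ^ 3) (- \<epsilon> * q ^ 2) q (- 1 - int r) (- 1 - int s)
      = hecke_term \<epsilon> q (r + s) s * q ^ (6 * (r + s) + 6)"
proof -
  have \<epsilon>': "- \<epsilon> = 1 \<or> - \<epsilon> = -1" using \<epsilon> by auto
  \<comment> \<open>Exponents are compared after doubling, which clears the halves in
    \<open>binom2\<close> and in the triangular number.\<close>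
  have "2 * (int 3 * int r + int 2 * int s
        + (4 * binom2 (int r) + 4 * int r * int s + 3 * binom2 (int s)))
      = 2 * (2 * (int (r + s))\<^sup>2 + int (r + s) - int s * (int s + 1) div 2)"
    using two_binom2[of "int r"] two_binom2[of "int s"] two_tri_int[of "int s"]
    unfolding of_nat_add power2_eq_square by (simp add: algebra_simps)
  then have e: "int 3 * int r + int 2 * int s
        + (4 * binom2 (int r) + 4 * int r * int s + 3 * binom2 (int s))
      = 2 * (int (r + s))\<^sup>2 + int (r + s) - int s * (int s + 1) div 2"
    by simp
  have "\<epsilon> powi (int r + int s) = \<epsilon> ^ (r + s)"
    by (metis of_nat_add power_int_of_nat)
  then show "dsum_term 4 4 3 (- \<epsilon> * q ^ 3) (- \<epsilon> * q ^ 2) q (int r) (int s) = hecke_term \<epsilon> q (r + s) s"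
    unfolding dsum_term_unit[OF assms(1) \<epsilon>'] e hecke_term_def by simp
  have "2 * (int 3 * (- 1 - int r) + int 2 * (- 1 - int s)
        + (4 * binom2 (- 1 - int r) + 4 * (- 1 - int r) * (- 1 - int s) + 3 * binom2 (- 1 - int s)))
      = 2 * (2 * (int (r + s))\<^sup>2 + int (r + s) - int s * (int s + 1) div 2 + int (6 * (r + s) + 6))"
    using two_binom2[of "- 1 - int r"] two_binom2[of "- 1 - int s"] two_tri_int[of "int s"]
    unfolding of_nat_add power2_eq_square by (simp add: algebra_simps)
  then have e: "int 3 * (- 1 - int r) + int 2 * (- 1 - int s)
        + (4 * binom2 (- 1 - int r) + 4 * (- 1 - int r) * (- 1 - int s) + 3 * binom2 (- 1 - int s))
      = 2 * (int (r + s))\<^sup>2 + int (r + s) - int s * (int s + 1) div 2 + int (6 * (r + s) + 6)"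
    by simp
  have "\<epsilon> powi (- 1 - int r + (- 1 - int s)) = \<epsilon> ^ (r + s)"
    using \<epsilon> by (auto simp: power_int_minus_left minus_one_power_iff)
  then show "dsum_term 4 4 3 (- \<epsilon> * q ^ 3) (- \<epsilon> * q ^ 2) q (- 1 - int r) (- 1 - int s)
      = hecke_term \<epsilon> q (r + s) s * q ^ (6 * (r + s) + 6)"
    unfolding dsum_term_unit[OF assms(1) \<epsilon>'] e hecke_term_def
    using assms(1) by (simp add: power_int_add del: of_nat_add)
qed

text \<open>Write \<open>D\<close> as the sum of \<open>a n - b n\<close>. Since
  \<open>alpha1\<close> combines the partial sums at \<open>n\<close> and \<open>n - 2\<close>, its
  term times q^(n^2) is \<open>a n - b (n - 2)\<close>; moving \<open>b\<close> by two places does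
  not change the total.\<close>

lemma hecke_identities:
  assumes q: "q \<noteq> 0" "norm q < 1" and \<epsilon>: "\<epsilon> = 1 \<or> \<epsilon> = -1"
  defines "D \<equiv> \<Sum>n. \<Sum>m = 0..int n. \<epsilon> ^ n * (1 - q ^ (6 * n + 6))
              * q powi (2 * (int n)\<^sup>2 + int n - m * (m + 1) div 2)"
  shows "(\<Sum>n. q ^ (n\<^sup>2) * bailey1 \<epsilon> q n) = 1 / qpoch_inf q q * D"
    and "D = dsum_f 4 4 3 (- \<epsilon> * q ^ 3) (- \<epsilon> * q ^ 2) q"
proof -
  define a where "a n = (\<Sum>m\<le>n. hecke_term \<epsilon> q n m)" for n
  define b where "b n = (\<Sum>m\<le>n. hecke_term \<epsilon> q n m * q ^ (6 * n + 6))" for n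
  have bound1: "norm (hecke_term \<epsilon> q n m) \<le> 1 * real (Suc n) * norm q ^ n" if "m \<le> n" for n m
  proof -
    have "norm (hecke_term \<epsilon> q n m) \<le> 1 * norm q ^ n"
      using norm_hecke_term_le[OF q \<epsilon> that] by simp
    also have "\<dots> \<le> 1 * real (Suc n) * norm q ^ n"
      by (intro mult_right_mono) auto
    finally show ?thesis .
  qed
  have bound2: "norm (hecke_term \<epsilon> q n m * q ^ (6 * n + 6)) \<le> 1 * real (Suc n) * norm q ^ n"
    if "m \<le> n" for n m
  proof -
    have "norm (hecke_term \<epsilon> q n m * q ^ (6 * n + 6)) \<le> norm (hecke_term \<epsilon> q n m) * 1"
      unfolding norm_mult using norm_pow_le[OF q(2) le0, of "6 * n + 6"]
      by (intro mult_left_mono) auto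
    with bound1[OF that] show ?thesis by simp
  qed
  have \<rho>: "0 \<le> norm q" by simp
  note triangle1 = has_sum_triangle[of _ "\<lambda>n m. hecke_term \<epsilon> q n m", OF \<rho> q(2) bound1]
  note triangle2 = has_sum_triangle[of _ "\<lambda>n m. hecke_term \<epsilon> q n m * q ^ (6 * n + 6)", OF \<rho> q(2) bound2]
  have a: "a sums suminf a" and b: "b sums suminf b"
    using triangle1(1) triangle2(1) by (simp_all add: a_def[abs_def] b_def[abs_def] summable_sums)
  have D: "D = (\<Sum>n. a n - b n)"
    unfolding D_def a_def b_def sum_int_atMost
    by (simp only: sum_subtractf[symmetric]) (simp add: hecke_term_def algebra_simps)
  have ab: "suminf a - suminf b = D"
    unfolding D using sums_unique[OF sums_diff[OF a b]] by simp
  show "D = dsum_f 4 4 3 (- \<epsilon> * q ^ 3) (- \<epsilon> * q ^ 2) q"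
  proof -
    have "(\<Sum>\<^sub>\<infinity>(r, s)\<in>{0..} \<times> {0..}. dsum_term 4 4 3 (- \<epsilon> * q ^ 3) (- \<epsilon> * q ^ 2) q r s) = suminf a"
      using triangle1(2) by (intro infsum_nonneg_quadrant) (simp only: dsum_term_hecke[OF q(1) \<epsilon>] a_def[abs_def])
    moreover have "(\<Sum>\<^sub>\<infinity>(r, s)\<in>{..<0} \<times> {..<0}. dsum_term 4 4 3 (- \<epsilon> * q ^ 3) (- \<epsilon> * q ^ 2) q r s) = suminf b"
      using triangle2(2) by (intro infsum_neg_quadrant) (simp only: dsum_term_hecke[OF q(1) \<epsilon>] b_def[abs_def])
    ultimately show ?thesis by (simp add: dsum_f_def ab)
  qed
  have a_eq: "a n = \<epsilon> ^ n * q ^ (2 * n\<^sup>2 + n) * tri_sum q n" for n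
    unfolding a_def hecke_term_eq[OF q(1)] tri_sum_def by (simp add: sum_distrib_left)
  have b_eq: "b n = a n * q ^ (6 * n + 6)" for n
    unfolding b_def a_def by (simp add: sum_distrib_right)
  \<comment> \<open>\<open>b\<close> delayed by two places; the leading zeros correspond to empty
    partial sums at the indices -2 and -1.\<close>
  define b' where "b' n = (if n < 2 then 0 else b (n - 2))" for n
  have "b' sums suminf b"
    using sums_iff_shift[of b' 2 "suminf b"] b by (simp add: b'_def numeral_2_eq_2)
  then have "(\<lambda>n. a n - b' n) sums D"
    unfolding ab[symmetric] by (intro sums_diff a)
  moreover have "(if n = 0 then 1 else \<epsilon> ^ n * alpha1 q n) * q ^ (n\<^sup>2) = a n - b' n" for n
  proof -
    consider "n = 0" | "n = 1" | k where "n = Suc (Suc k)"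
      by (metis One_nat_def not0_implies_Suc)
    then show ?thesis
    proof cases
      case 1
      then show ?thesis by (simp add: a_eq b'_def tri_sum_def tri_inv_def)
    next
      case 2
      then show ?thesis
        using q(1) by (simp add: a_eq b'_def tri_sum_def tri_inv_def alpha1_def bailey1_alpha_def
            power2_eq_square field_simps eval_nat_numeral)
    next
      case (3 k)
      have S: "tri_sum q n - tri_inv q n - q ^ n * tri_inv q n = tri_sum q k"
        using q(1) by (simp add: 3 tri_sum_def tri_inv_Suc)
      have e: "\<epsilon> ^ n = \<epsilon> ^ k"
        using \<epsilon> by (auto simp: 3)
      have "q ^ (n\<^sup>2) * q ^ (n\<^sup>2) * q ^ n = q ^ (2 * n\<^sup>2 + n)"
        by (simp add: mult_2 power_add)
      moreover have "q ^ (n\<^sup>2) * q ^ (n\<^sup>2) / q ^ n = q ^ (2 * k\<^sup>2 + k) * q ^ (6 * k + 6)"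
      proof -
        have "q ^ (n\<^sup>2) * q ^ (n\<^sup>2) = q ^ (2 * k\<^sup>2 + k) * q ^ (6 * k + 6) * q ^ n"
          unfolding power_add[symmetric]
          by (rule arg_cong[of _ _ "(^) q"]) (simp add: 3 power2_eq_square algebra_simps)
        then show ?thesis using q(1) by simp
      qed
      moreover have "\<epsilon> ^ n * alpha1 q n * q ^ (n\<^sup>2)
          = \<epsilon> ^ n * (q ^ (n\<^sup>2) * q ^ (n\<^sup>2) * q ^ n) * tri_sum q n
            - \<epsilon> ^ n * (q ^ (n\<^sup>2) * q ^ (n\<^sup>2) / q ^ n) * tri_sum q k"
        unfolding alpha1_def bailey1_alpha_def S by (simp add: algebra_simps)
      ultimately have "\<epsilon> ^ n * alpha1 q n * q ^ (n\<^sup>2)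
          = a n - \<epsilon> ^ n * (q ^ (2 * k\<^sup>2 + k) * q ^ (6 * k + 6)) * tri_sum q k"
        by (simp only: a_eq)
      also have "\<epsilon> ^ n * (q ^ (2 * k\<^sup>2 + k) * q ^ (6 * k + 6)) * tri_sum q k = b' n"
        by (simp only: e) (simp add: b'_def b_eq a_eq 3)
      finally show ?thesis by (simp add: 3)
    qed
  qed
  ultimately have "(\<lambda>n. (if n = 0 then 1 else \<epsilon> ^ n * alpha1 q n) * q ^ (n\<^sup>2)) sums D"
    by simp
  from sums_mult[OF this, of "1 / qpoch_inf q q"]
  have "(\<lambda>n. (if n = 0 then 1 else \<epsilon> ^ n * alpha1 q n) * (q ^ (n\<^sup>2) / qpoch_inf q q)) sums (1 / qpoch_inf q q * D)"
    by (simp add: mult_ac)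
  then show "(\<Sum>n. q ^ (n\<^sup>2) * bailey1 \<epsilon> q n) = 1 / qpoch_inf q q * D"
    using bailey_limit1[OF q \<epsilon>] sums_unique2 by blast
qed

section \<open>The double sums of the third identity\<close>

lemma sum_even_odd:
  fixes h :: "nat \<Rightarrow> 'a :: comm_monoid_add"
  shows "(\<Sum>k\<le>2 * n. h k) = (\<Sum>s\<le>n. h (2 * s)) + (\<Sum>s<n. h (2 * s + 1))"
  by (induction n) (simp_all add: ac_simps)

text \<open>Put m = n - k with 0 <= k <= 2n and split by the parity of k, which is that of m +
  n.\<close>

lemma sum_abs_le_int:
  fixes g :: "int \<Rightarrow> 'a :: comm_monoid_add"
  shows "(\<Sum>m | \<bar>m\<bar> \<le> int n. g m)
    = (\<Sum>s\<le>n. g (int n - 2 * int s)) + (\<Sum>s<n. g (int n - 1 - 2 * int s))"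
proof -
  have "(\<Sum>m | \<bar>m\<bar> \<le> int n. g m) = (\<Sum>k\<le>2 * n. g (int n - int k))"
    by (rule sum.reindex_bij_witness[of _ "\<lambda>k. int n - int k" "\<lambda>m. nat (int n - m)"]) auto
  then show ?thesis
    unfolding sum_even_odd by (simp add: algebra_simps)
qed

lemma alt_sum_eq:
  "alt_sum q n = (\<Sum>m | \<bar>m\<bar> \<le> int n. (-1) powi m * q powi (- (m\<^sup>2)))"
proof (induction n)
  case 0
  have "{m :: int. \<bar>m\<bar> \<le> int 0} = {0}" by auto
  then show ?case by (simp add: alt_sum_def)
next
  case (Suc n)
  define g where "g m = (-1) powi m * q powi (- (m\<^sup>2))" for m
  have fin: "finite {m :: int. \<bar>m\<bar> \<le> int n}"
    by (rule finite_subset[of _ "{- int n..int n}"]) auto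
  have "{m. \<bar>m\<bar> \<le> int (Suc n)} = insert (int (Suc n)) (insert (- int (Suc n)) {m. \<bar>m\<bar> \<le> int n})"
    by auto
  then have "(\<Sum>m | \<bar>m\<bar> \<le> int (Suc n). g m)
      = g (int (Suc n)) + (g (- int (Suc n)) + (\<Sum>m | \<bar>m\<bar> \<le> int n. g m))"
    using fin by simp
  moreover have "g (- m) = g m" for m
    by (simp add: g_def power_int_minus power_int_minus_left)
  moreover have "g (int (Suc n)) = alt_term q (Suc n)"
  proof -
    have "- ((int (Suc n))\<^sup>2) = - int ((Suc n)\<^sup>2)" by simp
    then show ?thesis
      unfolding g_def alt_term_def by (simp only: power_int_minus power_int_of_nat)
  qed
  ultimately have "(\<Sum>m | \<bar>m\<bar> \<le> int (Suc n). g m)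
      = alt_term q (Suc n) + (alt_term q (Suc n) + (\<Sum>m | \<bar>m\<bar> \<le> int n. g m))"
    by (simp only:)
  then show ?case
    using Suc by (simp add: g_def alt_sum_def algebra_simps)
qed

text \<open>The signs cancel completely, since (-1)^(r+s) meets (-1)^r (-1)^s from the negative
  arguments.\<close>

lemma dsum_term_indefinite:
  assumes "q \<noteq> 0"
  shows "dsum_term 1 2 1 (- (q ^ k)) (- (q ^ k)) (q ^ 4) r s
    = q powi (int k * (r + s) + 4 * (binom2 r + 2 * r * s + binom2 s))"
proof -
  have "dsum_term 1 2 1 (- (q ^ k)) (- (q ^ k)) (q ^ 4) r s
      = ((-1) powi (r + s) * ((-1) powi r * (-1) powi s))
        * ((q ^ k) powi r * (q ^ k) powi s * (q ^ 4) powi (binom2 r + 2 * r * s + binom2 s))"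
    unfolding dsum_term_def mult_minus1[of "q ^ k", symmetric] power_int_mult_distrib
    by (simp only: mult_ac mult_1)
  also have "(-1) powi (r + s) * ((-1) powi r * (-1) powi s) = (1 :: complex)"
    by (simp add: power_int_minus_left)
  also have "(q ^ k) powi r * (q ^ k) powi s * (q ^ 4) powi (binom2 r + 2 * r * s + binom2 s)
      = q powi (int k * r + int k * s + 4 * (binom2 r + 2 * r * s + binom2 s))"
    using assms by (simp add: power_int_add power_int_power)
  finally show ?thesis by (simp add: algebra_simps)
qed

text \<open>One family for all four quadrant sums: they differ only in the linear part
  \<open>b * n + c\<close>, and \<open>n - 2 * s\<close> plays the part of \<open>m\<close>.\<close>

definition quad_term :: "complex \<Rightarrow> int \<Rightarrow> int \<Rightarrow> nat \<Rightarrow> nat \<Rightarrow> complex" where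
  "quad_term q b c n s = q powi (3 * (int n)\<^sup>2 + b * int n + c - (int n - 2 * int s)\<^sup>2)"

lemma norm_quad_term_le:
  assumes "norm q < 1" "1 \<le> b" "0 \<le> c" "s \<le> n"
  shows "norm (quad_term q b c n s) \<le> 1 * real (Suc n) * norm q ^ n"
proof -
  have "(int n - 2 * int s)\<^sup>2 \<le> (int n)\<^sup>2"
    using assms(4) by (subst abs_le_square_iff [symmetric]) auto
  moreover have "1 * int n \<le> b * int n"
    using assms(2) by (intro mult_right_mono) auto
  moreover have "0 \<le> (int n)\<^sup>2" by simp
  ultimately have "int n \<le> 3 * (int n)\<^sup>2 + b * int n + c - (int n - 2 * int s)\<^sup>2"
    using assms(3) by linarith
  from norm_powi_le[OF assms(1) this]
  have "norm (quad_term q b c n s) \<le> 1 * norm q ^ n"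
    by (simp add: quad_term_def)
  also have "\<dots> \<le> 1 * real (Suc n) * norm q ^ n"
    by (intro mult_right_mono) auto
  finally show ?thesis .
qed

lemma dsum_term_quad:
  assumes "q \<noteq> 0"
  shows "dsum_term 1 2 1 (- (q ^ 3)) (- (q ^ 3)) (q ^ 4) (int r) (int s) = quad_term q 1 0 (r + s) s"
    and "dsum_term 1 2 1 (- (q ^ 3)) (- (q ^ 3)) (q ^ 4) (- 1 - int r) (- 1 - int s)
      = quad_term q 11 10 (r + s) s"
    and "q ^ 4 * dsum_term 1 2 1 (- (q ^ 9)) (- (q ^ 9)) (q ^ 4) (int r) (int s)
      = quad_term q 7 4 (r + s) s"
    and "q ^ 4 * dsum_term 1 2 1 (- (q ^ 9)) (- (q ^ 9)) (q ^ 4) (- 1 - int r) (- 1 - int s)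
      = quad_term q 5 2 (r + s) s"
proof -
  have q4: "q ^ 4 * q powi e = q powi (4 + e)" for e
    using assms by (simp add: power_int_add)
  have s: "int (r + s) - 2 * int s = int r - int s" by simp
  note b = two_binom2[of "int r"] two_binom2[of "int s"]
    two_binom2[of "- 1 - int r"] two_binom2[of "- 1 - int s"]
  show "dsum_term 1 2 1 (- (q ^ 3)) (- (q ^ 3)) (q ^ 4) (int r) (int s) = quad_term q 1 0 (r + s) s"
    unfolding dsum_term_indefinite[OF assms] quad_term_def s
    using b by (intro arg_cong[of _ _ "power_int q"]) (simp add: power2_eq_square algebra_simps)
  show "dsum_term 1 2 1 (- (q ^ 3)) (- (q ^ 3)) (q ^ 4) (- 1 - int r) (- 1 - int s)
      = quad_term q 11 10 (r + s) s"
    unfolding dsum_term_indefinite[OF assms] quad_term_def s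
    using b by (intro arg_cong[of _ _ "power_int q"]) (simp add: power2_eq_square algebra_simps)
  show "q ^ 4 * dsum_term 1 2 1 (- (q ^ 9)) (- (q ^ 9)) (q ^ 4) (int r) (int s)
      = quad_term q 7 4 (r + s) s"
    unfolding dsum_term_indefinite[OF assms] quad_term_def s q4
    using b by (intro arg_cong[of _ _ "power_int q"]) (simp add: power2_eq_square algebra_simps)
  show "q ^ 4 * dsum_term 1 2 1 (- (q ^ 9)) (- (q ^ 9)) (q ^ 4) (- 1 - int r) (- 1 - int s)
      = quad_term q 5 2 (r + s) s"
    unfolding dsum_term_indefinite[OF assms] quad_term_def s q4
    using b by (intro arg_cong[of _ _ "power_int q"]) (simp add: power2_eq_square algebra_simps)
qed

text \<open>Terms with m + n even give (b, c) = (1, 0) minus (5, 2). Those with m + n odd carry the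
  opposite sign and, after n = k + 1, give (7, 4) minus (11, 10). The first double sum collects (1,
  0) and (11, 10), the second (7, 4) and (5, 2).\<close>

lemma third_identity:
  assumes q: "q \<noteq> 0" "norm q < 1"
  defines "A \<equiv> \<lambda>n. \<Sum>m | \<bar>m\<bar> \<le> int n. (-1) powi (m + int n) * (1 - q ^ (4 * n + 2))
              * q powi (3 * (int n)\<^sup>2 + int n - m\<^sup>2)"
  shows "(\<Sum>n. (-1) ^ n * qpoch q (q\<^sup>2) n * q ^ (n\<^sup>2 + n) / qpoch (-q) q (2 * n)) = suminf A"
    and "suminf A = dsum_g 1 2 1 (- (q ^ 3)) (- (q ^ 3)) (q ^ 4)
         - q ^ 4 * dsum_g 1 2 1 (- (q ^ 9)) (- (q ^ 9)) (q ^ 4)"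
proof -
  have q2: "norm (q\<^sup>2) < 1"
    using norm_pow_mult_less_1[OF q(2) q(2), of 1] by (simp add: power2_eq_square)
  have "A n = alpha3 q n * ((-1) ^ n * q ^ (n\<^sup>2 + n))" for n
  proof -
    have "(-1) powi (m + int n) * (1 - q ^ (4 * n + 2)) * q powi (3 * (int n)\<^sup>2 + int n - m\<^sup>2)
      = (1 - q ^ (4 * n + 2)) * ((-1) ^ n * q ^ (3 * n\<^sup>2 + n)) * ((-1) powi m * q powi (- (m\<^sup>2)))" for m
    proof -
      have "(-1 :: complex) powi (m + int n) = (-1) powi m * (-1) ^ n"
        by (simp add: power_int_add)
      moreover have "3 * (int n)\<^sup>2 + int n - m\<^sup>2 = int (3 * n\<^sup>2 + n) + - (m\<^sup>2)"
        by simp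
      then have "q powi (3 * (int n)\<^sup>2 + int n - m\<^sup>2) = q ^ (3 * n\<^sup>2 + n) * q powi (- (m\<^sup>2))"
        using q(1) by (simp only: power_int_add power_int_of_nat simp_thms)
      ultimately show ?thesis by (simp only: mult_ac)
    qed
    then have "A n = (1 - q ^ (4 * n + 2)) * ((-1) ^ n * q ^ (3 * n\<^sup>2 + n)) * alt_sum q n"
      unfolding A_def alt_sum_eq by (simp only: sum_distrib_left)
    moreover have "q\<^sup>2 * (q\<^sup>2 ^ n)\<^sup>2 = q ^ (4 * n + 2)"
    proof -
      have "4 * n + 2 = 2 + 2 * n * 2" by simp
      then show ?thesis by (simp only: power_add power_mult)
    qed
    moreover have "q ^ (3 * n\<^sup>2 + n) = q ^ (2 * n\<^sup>2) * q ^ (n\<^sup>2 + n)"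
      unfolding power_add[symmetric] by simp
    ultimately show ?thesis
      unfolding alpha3_def bailey3_alpha_def by (simp only: mult_ac)
  qed
  then have "A sums (\<Sum>n. (-1) ^ n * q ^ (n\<^sup>2 + n) * qpoch (q\<^sup>2) (q\<^sup>2) n * bailey3 q n)"
    using bailey_limit3[OF q] by presburger
  moreover have "(-1) ^ n * q ^ (n\<^sup>2 + n) * qpoch (q\<^sup>2) (q\<^sup>2) n * bailey3 q n
      = (-1) ^ n * qpoch q (q\<^sup>2) n * q ^ (n\<^sup>2 + n) / qpoch (-q) q (2 * n)" for n
    using qpoch_nonzero[OF q2 q2, of n] by (simp add: bailey3_eq[OF q])
  ultimately show "(\<Sum>n. (-1) ^ n * qpoch q (q\<^sup>2) n * q ^ (n\<^sup>2 + n) / qpoch (-q) q (2 * n)) = suminf A"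
    using sums_unique by force

  define h where "h b c n = (\<Sum>s\<le>n. quad_term q b c n s)" for b c n
  have \<rho>: "0 \<le> norm q" by simp
  note triangle = has_sum_triangle[OF \<rho> q(2) norm_quad_term_le[OF q(2)]]
  have h: "h b c sums suminf (h b c)" if "1 \<le> b" "0 \<le> c" for b c
    using triangle(1)[OF that] by (simp add: h_def[abs_def] summable_sums)
  have quad: "((\<lambda>(r, s). quad_term q b c (r + s) s) has_sum suminf (h b c)) UNIV" if "1 \<le> b" "0 \<le> c" for b c
    using triangle(2)[OF that] by (simp add: h_def[abs_def])
  have "dsum_g 1 2 1 (- (q ^ 3)) (- (q ^ 3)) (q ^ 4) = suminf (h 1 0) + suminf (h 11 10)"
    unfolding dsum_g_def
    by (intro arg_cong2[of _ _ _ _ "(+)"] infsum_nonneg_quadrant infsum_neg_quadrant)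
       (simp_all only: dsum_term_quad[OF q(1)], use quad in auto)
  \<comment> \<open>The prefactor is moved under the sum so that it merges with the exponent of each
    term.\<close>
  moreover have scale: "q ^ 4 * (\<Sum>\<^sub>\<infinity>(r, s)\<in>B. t r s) = (\<Sum>\<^sub>\<infinity>(r, s)\<in>B. q ^ 4 * t r s)"
    for t :: "int \<Rightarrow> int \<Rightarrow> complex" and B
    by (simp add: case_prod_unfold infsum_cmult_right')
  have "q ^ 4 * dsum_g 1 2 1 (- (q ^ 9)) (- (q ^ 9)) (q ^ 4) = suminf (h 7 4) + suminf (h 5 2)"
    unfolding dsum_g_def distrib_left scale
    by (intro arg_cong2[of _ _ _ _ "(+)"] infsum_nonneg_quadrant infsum_neg_quadrant)
       (simp_all only: dsum_term_quad[OF q(1)], use quad in auto)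
  moreover have "suminf A = suminf (h 1 0) - suminf (h 5 2) - (suminf (h 7 4) - suminf (h 11 10))"
  proof -
    \<comment> \<open>The odd part at \<open>n\<close> is indexed by \<open>k = n - 1\<close> and is
      empty at \<open>n = 0\<close>, hence the shift with a leading zero.\<close>
    define h' where "h' n = (case n of 0 \<Rightarrow> 0 | Suc k \<Rightarrow> h 7 4 k - h 11 10 k)" for n
    have "(\<lambda>k. h 7 4 k - h 11 10 k) sums (suminf (h 7 4) - suminf (h 11 10))"
      by (intro sums_diff h) auto
    then have "h' sums (suminf (h 7 4) - suminf (h 11 10))"
      using sums_Suc_iff[of h' "suminf (h 7 4) - suminf (h 11 10)"] by (simp add: h'_def)
    then have S: "(\<lambda>n. h 1 0 n - h 5 2 n - h' n) sums
        (suminf (h 1 0) - suminf (h 5 2) - (suminf (h 7 4) - suminf (h 11 10)))"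
      by (intro sums_diff h) auto
    have A: "A n = h 1 0 n - h 5 2 n - h' n" for n
    proof -
      have pw: "(1 - q ^ k) * q powi e = q powi e - q powi (e + int k)" for k e
        using q(1) by (simp add: power_int_add algebra_simps)
      have "(\<Sum>s\<le>n. (-1) powi ((int n - 2 * int s) + int n) * (1 - q ^ (4 * n + 2))
              * q powi (3 * (int n)\<^sup>2 + int n - (int n - 2 * int s)\<^sup>2)) = h 1 0 n - h 5 2 n"
        unfolding h_def sum_subtractf[symmetric]
      proof (rule sum.cong[OF refl])
        fix s
        have "(-1 :: complex) powi ((int n - 2 * int s) + int n) = 1"
          by (simp add: power_int_minus_left)
        then show "(-1) powi ((int n - 2 * int s) + int n) * (1 - q ^ (4 * n + 2))
              * q powi (3 * (int n)\<^sup>2 + int n - (int n - 2 * int s)\<^sup>2)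
            = quad_term q 1 0 n s - quad_term q 5 2 n s"
          unfolding quad_term_def mult.assoc pw by (simp add: algebra_simps)
      qed
      moreover have "(\<Sum>s<n. (-1) powi ((int n - 1 - 2 * int s) + int n) * (1 - q ^ (4 * n + 2))
              * q powi (3 * (int n)\<^sup>2 + int n - (int n - 1 - 2 * int s)\<^sup>2)) = - h' n"
      proof (cases n)
        case (Suc k)
        have "(-1) powi ((int n - 1 - 2 * int s) + int n) * (1 - q ^ (4 * n + 2))
              * q powi (3 * (int n)\<^sup>2 + int n - (int n - 1 - 2 * int s)\<^sup>2)
            = - (quad_term q 7 4 k s - quad_term q 11 10 k s)" for s
        proof -
          have "(-1 :: complex) powi ((int n - 1 - 2 * int s) + int n) = - 1"
            by (simp add: power_int_minus_left)
          moreover have "int n - 1 - 2 * int s = int k - 2 * int s"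
            by (simp add: Suc)
          moreover have "3 * (int n)\<^sup>2 + int n - (int k - 2 * int s)\<^sup>2
              = 3 * (int k)\<^sup>2 + 7 * int k + 4 - (int k - 2 * int s)\<^sup>2"
            by (simp add: Suc power2_eq_square algebra_simps)
          moreover have "3 * (int k)\<^sup>2 + 7 * int k + 4 - (int k - 2 * int s)\<^sup>2 + int (4 * n + 2)
              = 3 * (int k)\<^sup>2 + 11 * int k + 10 - (int k - 2 * int s)\<^sup>2"
            by (simp add: Suc)
          ultimately show ?thesis
            unfolding quad_term_def mult.assoc pw by (simp only: mult_minus1)
        qed
        then have "(\<Sum>s<n. (-1) powi ((int n - 1 - 2 * int s) + int n) * (1 - q ^ (4 * n + 2))
              * q powi (3 * (int n)\<^sup>2 + int n - (int n - 1 - 2 * int s)\<^sup>2))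
            = (\<Sum>s\<le>k. - (quad_term q 7 4 k s - quad_term q 11 10 k s))"
          by (simp only: Suc lessThan_Suc_atMost)
        also have "\<dots> = - h' n"
          by (simp add: Suc h'_def h_def sum_subtractf)
        finally show ?thesis .
      qed (simp add: h'_def)
      ultimately show ?thesis
        unfolding A_def sum_abs_le_int by (simp only: diff_conv_add_uminus)
    qed
    have "A sums (suminf (h 1 0) - suminf (h 5 2) - (suminf (h 7 4) - suminf (h 11 10)))"
      using S by (simp only: A[symmetric])
    then show ?thesis
      by (rule sums_unique[symmetric])
  qed
  ultimately show "suminf A = dsum_g 1 2 1 (- (q ^ 3)) (- (q ^ 3)) (q ^ 4)
         - q ^ 4 * dsum_g 1 2 1 (- (q ^ 9)) (- (q ^ 9)) (q ^ 4)"
    by simp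
qed

theorem theorem2p7:
  fixes q :: complex
  assumes "0 < norm q" and "norm q < 1"
  shows
    "((\<Sum>n. q ^ (n\<^sup>2) * (qpoch (-q) q n)\<^sup>2 / qpoch q q (2 * n))
       = 1 / qpoch_inf q q
         * (\<Sum>n. \<Sum>m = 0..int n. (1 - q ^ (6 * n + 6))
              * q powi (2 * (int n)\<^sup>2 + int n - m * (m + 1) div 2))
     \<and> 1 / qpoch_inf q q
         * (\<Sum>n. \<Sum>m = 0..int n. (1 - q ^ (6 * n + 6))
              * q powi (2 * (int n)\<^sup>2 + int n - m * (m + 1) div 2))
       = 1 / qpoch_inf q q * dsum_f 4 4 3 (- (q ^ 3)) (- (q ^ 2)) q)
     \<and> ((\<Sum>n. q ^ (n\<^sup>2) / qpoch q (q\<^sup>2) n)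
       = 1 / qpoch_inf q q
         * (\<Sum>n. \<Sum>m = 0..int n. (-1) ^ n * (1 - q ^ (6 * n + 6))
              * q powi (2 * (int n)\<^sup>2 + int n - m * (m + 1) div 2))
     \<and> 1 / qpoch_inf q q
         * (\<Sum>n. \<Sum>m = 0..int n. (-1) ^ n * (1 - q ^ (6 * n + 6))
              * q powi (2 * (int n)\<^sup>2 + int n - m * (m + 1) div 2))
       = 1 / qpoch_inf q q * dsum_f 4 4 3 (q ^ 3) (q ^ 2) q)
     \<and> ((\<Sum>n. (-1) ^ n * qpoch q (q\<^sup>2) n * q ^ (n\<^sup>2 + n) / qpoch (-q) q (2 * n))
       = (\<Sum>n. \<Sum>m | \<bar>m\<bar> \<le> int n. (-1) powi (m + int n) * (1 - q ^ (4 * n + 2))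
              * q powi (3 * (int n)\<^sup>2 + int n - m\<^sup>2))
     \<and> (\<Sum>n. \<Sum>m | \<bar>m\<bar> \<le> int n. (-1) powi (m + int n) * (1 - q ^ (4 * n + 2))
              * q powi (3 * (int n)\<^sup>2 + int n - m\<^sup>2))
       = dsum_g 1 2 1 (- (q ^ 3)) (- (q ^ 3)) (q ^ 4)
         - q ^ 4 * dsum_g 1 2 1 (- (q ^ 9)) (- (q ^ 9)) (q ^ 4))"
proof -
  have q: "q \<noteq> 0" "norm q < 1" using assms by auto
  have 1: "q ^ (n\<^sup>2) * (qpoch (-q) q n)\<^sup>2 / qpoch q q (2 * n) = q ^ (n\<^sup>2) * bailey1 1 q n"
    and 2: "q ^ (n\<^sup>2) / qpoch q (q\<^sup>2) n = q ^ (n\<^sup>2) * bailey1 (-1) q n" for n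
    by (simp_all add: bailey1_plus[OF q] bailey1_minus[OF q])
  show ?thesis
    unfolding 1 2
    using hecke_identities[OF q, of 1] hecke_identities[OF q, of "-1"] third_identity[OF q]
    by (simp only: power_one mult_1 minus_minus mult_minus1 simp_thms)
qed

end
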